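(* Let $\mathcal{Q}=(Q_{B_1B_2})_{B_1\subseteq B_2}$ be a transition system, let $P=(P_A)_{A\in\mathcal{B}}$ be a $\mathcal{Q}$-Markov random probability measure on $\mathcal{X}$, and let $\underline{X}=(X_1,\ldots,X_n)$ be a sample from $P$. For $B_1\subseteq B_2$ in $\mathcal{A}(u)$ and $\Gamma_2\in\mathcal{B}([0,1])$ let $$Q^{(\underline{x})}_{B_1B_2}(z_1;\Gamma_2):=\mathcal{P}[P_{B_2}\in\Gamma_2\mid \underline{X}=\underline{x},\,P_{B_1}=z_1].$$ Then the family $\mathcal{Q}^{(\underline{x})}=(Q^{(\underline{x})}_{B_1B_2})_{B_1\subseteq B_2}$ is a posterior transition system, and the conditional distribution of $P$ given $\underline{X}=\underline{x}$ is $\mathcal{Q}^{(\underline{x})}$-Markov. That is: (1) for all $B_1\subseteq B_2\subseteq B_3$ in $\mathcal{A}(u)$ and all $\Gamma_3\in\mathcal{B}([0,1])$, for $\nu_{B_1}$-almost all $(\underline{x},z_1)$, $$Q^{(\underline{x})}_{B_1B_3}(z_1;\Gamma_3)=\int_{[0,1]}Q^{(\underline{x})}_{B_2B_3}(z_2;\Gamma_3)\,Q^{(\underline{x})}_{B_1B_2}(z_1;dz_2);$$ (2) for all $B_1\subseteq B_2$ in $\mathcal{A}(u)$ and all $\Gamma_2\in\mathcal{B}([0,1])$, $$\mathcal{P}[P_{B_2}\in\Gamma_2\mid\mathcal{F}_{B_1},\underline{X}]=Q^{(\underline{X})}_{B_1B_2}(P_{B_1};\Gamma_2)\quad\text{a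.s.}$$
   Context: Setting. $\mathcal{X}$ is a Hausdorff topological space with Borel $\sigma$-field $\mathcal{B}$. There is a fixed collection $\mathcal{A}$ of closed subsets of $\mathcal{X}$ (an indexing collection) with $\sigma(\mathcal{A})=\mathcal{B}$ such that: (1) $\emptyset,\mathcal{X}\in\mathcal{A}$; (2) $\mathcal{A}$ is closed under arbitrary intersections; (3) if $A,B\in\mathcal{A}$ are nonempty then $A\cap B\ne\emptyset$; (4) there is a sequence $(\mathcal{A}_n)_n$ of finite sub-semilattices of $\mathcal{A}$ (finite subcollections closed under intersection) such that for every $A\in\mathcal{A}$ there exist $A_n\in\mathcal{A}_n(u)$ with $A=\bigcap_nA_n$ and $A\subseteq A_n^0$ (the interior of $A_n$) for all $n$, where $\mathcal{A}_n(u)$ is the class of finite unions of sets of $\mathcal{A}_n$. $\mathcal{A}(u)$ denotes the class of all finite unions of sets in $\mathcal{A}$. Random probability measure. A collection $P=(P_A)_{A\in\mathcal{B}}$ of $[0,1]$-valued random variables on a probability space $(\Omega,\mathcal{F},\mathcal{P})$ such that: (i) it is finitely additive in distribution: for pairwise disjoint $A_1,\ldots,A_k\in\mathcal{B}$ and $1\le i_1<\cdots<i_m\le k$, with $i_0=0$, $i_{m+1}=k$, the vectors $(P_{\bigcup_{j=i_l+1}^{i_{l+1}}A_j})_{l=0,\ldots,m}$ and $(\sum_{j=i_l+1}^{i_{l+1}}P_{A_j})_{l=0,\ldots,m}$ have the same distribution; (ii) $P_{\mathcal{X}}=1$ a.s.; (iii) for every decreasing sequence $(A_n)_n\subseteq\mathcal{B}$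 with $\bigcap_nA_n=\emptyset$, $\lim_nP_{A_n}=0$ a.s. Transition system. A family $\mathcal{Q}=(Q_{B_1B_2})_{B_1\subseteq B_2}$, indexed by pairs $B_1\subseteq B_2$ in $\mathcal{A}(u)$, of transition probabilities (Markov kernels) on $[0,1]$ such that for all $B_1\subseteq B_2\subseteq B_3$ in $\mathcal{A}(u)$, $z_1\in[0,1]$, $\Gamma_3\in\mathcal{B}([0,1])$: $Q_{B_1B_3}(z_1;\Gamma_3)=\int_{[0,1]}Q_{B_2B_3}(z_2;\Gamma_3)Q_{B_1B_2}(z_1;dz_2)$. $\mathcal{Q}$-Markov. $P$ is $\mathcal{Q}$-Markov if for all $B_1\subseteq B_2$ in $\mathcal{A}(u)$ and $\Gamma_2\in\mathcal{B}([0,1])$, $\mathcal{P}[P_{B_2}\in\Gamma_2\mid\mathcal{F}_{B_1}]=Q_{B_1B_2}(P_{B_1};\Gamma_2)$ a.s., where $\mathcal{F}_{B_1}:=\sigma(\{P_A:A\in\mathcal{A},A\subseteq B_1\})$. Sample. $\underline{X}=(X_1,\ldots,X_n)$ is a sample from $P$ if $X_1,\dots,X_n:\Omega\to\mathcal{X}$ are measurable and $\mathcal{P}[X_1\in A_1,\ldots,X_n\in A_n\mid P]=\prod_{i=1}^nP_{A_i}$ a.s. for all $A_1,\ldots,A_n\in\mathcal{B}$. $\nu_{B_1}$ denotes the law of $(X_1,\ldots,X_n,P_{B_1})$ under $\mathcal{P}$. $Q^{(\underline{x})}_{B_1B_2}(z_1;\cdot)$ is a regular conditional distribution, determined for $\nu_{B_1}$-almost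 all $(\underline{x},z_1)$. *)

theory Defs
  imports "HOL-Probability.Probability"
begin

text \<open>The space \<open>\<X>\<close> is the type \<open>'x\<close> (of class \<^class>\<open>t2_space\<close>), its Borel
  \<open>\<sigma>\<close>-field is \<^term>\<open>borel\<close>, and the basic probability space is the measure \<open>M\<close>.\<close>

text \<open>The empty union is included; as \<open>{} \<in> \<A>\<close> for an indexing collection, this does not
  affect \<open>\<A>(u)\<close>.\<close>

definition finite_unions :: "'x set set \<Rightarrow> 'x set set" where
  "finite_unions \<A> = {\<Union>\<F> | \<F>. finite \<F> \<and> \<F> \<subseteq> \<A>}"

definition indexing_collection :: "'x::t2_space set set \<Rightarrow> bool" where
  "indexing_collection \<A> \<longleftrightarrow>
     (\<forall>A\<in>\<A>. closed A) \<and>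
     sigma_sets UNIV \<A> = sets borel \<and>
     {} \<in> \<A> \<and> UNIV \<in> \<A> \<and>
     (\<forall>\<S>. \<S> \<subseteq> \<A> \<and> \<S> \<noteq> {} \<longrightarrow> \<Inter>\<S> \<in> \<A>) \<and>
     (\<forall>A\<in>\<A>. \<forall>B\<in>\<A>. A \<noteq> {} \<and> B \<noteq> {} \<longrightarrow> A \<inter> B \<noteq> {}) \<and>
     (\<exists>\<A>s :: nat \<Rightarrow> 'x set set.
        (\<forall>n. finite (\<A>s n) \<and> \<A>s n \<subseteq> \<A> \<and> (\<forall>A\<in>\<A>s n. \<forall>B\<in>\<A>s n. A \<inter> B \<in> \<A>s n)) \<and>
        (\<forall>A\<in>\<A>. \<exists>An :: nat \<Rightarrow> 'x set.
           (\<forall>n. An n \<in> finite_unions (\<A>s n)) \<and> A = (\<Inter>n. An n) \<and>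
           (\<forall>n. A \<subseteq> interior (An n))))"

abbreviation unit_borel :: "real measure" where
  "unit_borel \<equiv> restrict_space borel {0..1}"

definition cond_probability :: "'w measure \<Rightarrow> 'w measure \<Rightarrow> 'w set \<Rightarrow> 'w \<Rightarrow> real" where
  "cond_probability M F E = real_cond_exp M F (indicator E)"

text \<open>The \<open>\<sigma>\<close>-field \<open>\<sigma>({P\<^sub>A : A \<in> \<C>})\<close> on the sample space of \<open>M\<close>.\<close>

definition generated_field ::
  "'w measure \<Rightarrow> ('x set \<Rightarrow> 'w \<Rightarrow> real) \<Rightarrow> 'x set set \<Rightarrow> 'w measure" where
  "generated_field M P \<C> =
     sigma (space M) {P A -` S \<inter> space M | A S. A \<in> \<C> \<and> S \<in> sets unit_borel}"

definition random_probability_measure ::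
  "'w measure \<Rightarrow> ('x::t2_space set \<Rightarrow> 'w \<Rightarrow> real) \<Rightarrow> bool" where
  "random_probability_measure M P \<longleftrightarrow>
     (\<forall>A\<in>sets borel. P A \<in> M \<rightarrow>\<^sub>M unit_borel) \<and>
     (\<forall>(k::nat) (m::nat) (A :: nat \<Rightarrow> 'x set) (i :: nat \<Rightarrow> nat).
        1 \<le> m \<and> (\<forall>j\<in>{1..k}. A j \<in> sets borel) \<and> disjoint_family_on A {1..k} \<and>
        strict_mono_on {1..m} i \<and> (\<forall>l\<in>{1..m}. 1 \<le> i l \<and> i l \<le> k) \<and>
        i 0 = 0 \<and> i (m + 1) = k \<longrightarrow>
        distr M (\<Pi>\<^sub>M l\<in>{0..m}. borel)
          (\<lambda>\<omega>. \<lambda>l\<in>{0..m}. P (\<Union>j\<in>{i l + 1..i (l + 1)}. A j) \<omega>) =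
        distr M (\<Pi>\<^sub>M l\<in>{0..m}. borel)
          (\<lambda>\<omega>. \<lambda>l\<in>{0..m}. \<Sum>j\<in>{i l + 1..i (l + 1)}. P (A j) \<omega>)) \<and>
     (AE \<omega> in M. P UNIV \<omega> = 1) \<and>
     (\<forall>A :: nat \<Rightarrow> 'x set.
        (\<forall>n. A n \<in> sets borel) \<and> decseq A \<and> (\<Inter>n. A n) = {} \<longrightarrow>
        (AE \<omega> in M. (\<lambda>n. P (A n) \<omega>) \<longlonglongrightarrow> 0))"

definition transition_system ::
  "'x set set \<Rightarrow> ('x set \<Rightarrow> 'x set \<Rightarrow> real \<Rightarrow> real measure) \<Rightarrow> bool" where
  "transition_system \<A> Q \<longleftrightarrow>
     (\<forall>B1\<in>finite_unions \<A>. \<forall>B2\<in>finite_unions \<A>. B1 \<subseteq> B2 \<longrightarrow>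
        Q B1 B2 \<in> unit_borel \<rightarrow>\<^sub>M prob_algebra unit_borel) \<and>
     (\<forall>B1\<in>finite_unions \<A>. \<forall>B2\<in>finite_unions \<A>. \<forall>B3\<in>finite_unions \<A>.
        B1 \<subseteq> B2 \<and> B2 \<subseteq> B3 \<longrightarrow>
        (\<forall>z1\<in>{0..1}. \<forall>\<Gamma>3\<in>sets unit_borel.
           measure (Q B1 B3 z1) \<Gamma>3 = (\<integral>z2. measure (Q B2 B3 z2) \<Gamma>3 \<partial>Q B1 B2 z1)))"

definition past_field ::
  "'w measure \<Rightarrow> 'x set set \<Rightarrow> ('x set \<Rightarrow> 'w \<Rightarrow> real) \<Rightarrow> 'x set \<Rightarrow> 'w measure" where
  "past_field M \<A> P B = generated_field M P {A \<in> \<A>. A \<subseteq> B}"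

definition Q_Markov ::
  "'w measure \<Rightarrow> 'x set set \<Rightarrow> ('x set \<Rightarrow> 'x set \<Rightarrow> real \<Rightarrow> real measure) \<Rightarrow>
   ('x set \<Rightarrow> 'w \<Rightarrow> real) \<Rightarrow> bool" where
  "Q_Markov M \<A> Q P \<longleftrightarrow>
     (\<forall>B1\<in>finite_unions \<A>. \<forall>B2\<in>finite_unions \<A>. B1 \<subseteq> B2 \<longrightarrow>
        (\<forall>\<Gamma>2\<in>sets unit_borel. AE \<omega> in M.
           cond_probability M (past_field M \<A> P B1) {\<omega>'\<in>space M. P B2 \<omega>' \<in> \<Gamma>2} \<omega> =
           measure (Q B1 B2 (P B1 \<omega>)) \<Gamma>2))"

definition sample_from ::
  "'w measure \<Rightarrow> ('x::t2_space set \<Rightarrow> 'w \<Rightarrow> real) \<Rightarrow> nat \<Rightarrow> (nat \<Rightarrow> 'w \<Rightarrow> 'x) \<Rightarrow> bool" where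
  "sample_from M P n X \<longleftrightarrow>
     (\<forall>i\<in>{1..n}. X i \<in> M \<rightarrow>\<^sub>M borel) \<and>
     (\<forall>A :: nat \<Rightarrow> 'x set. (\<forall>i\<in>{1..n}. A i \<in> sets borel) \<longrightarrow>
        (AE \<omega> in M.
           cond_probability M (generated_field M P (sets borel))
             {\<omega>'\<in>space M. \<forall>i\<in>{1..n}. X i \<omega>' \<in> A i} \<omega> = (\<Prod>i\<in>{1..n}. P (A i) \<omega>)))"

text \<open>\<open>\<X>\<^sup>n\<close> carries the product of the Borel \<open>\<sigma>\<close>-fields, which may be smaller than the Borel
  \<open>\<sigma>\<close>-field of the product topology.\<close>

abbreviation sample_space :: "nat \<Rightarrow> (nat \<Rightarrow> 'x::t2_space) measure" where
  "sample_space n \<equiv> \<Pi>\<^sub>M i\<in>{1..n}. borel"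

definition sample_vector :: "nat \<Rightarrow> (nat \<Rightarrow> 'w \<Rightarrow> 'x) \<Rightarrow> 'w \<Rightarrow> nat \<Rightarrow> 'x" where
  "sample_vector n X \<omega> = (\<lambda>i\<in>{1..n}. X i \<omega>)"

definition sample_law ::
  "'w measure \<Rightarrow> ('x::t2_space set \<Rightarrow> 'w \<Rightarrow> real) \<Rightarrow> nat \<Rightarrow> (nat \<Rightarrow> 'w \<Rightarrow> 'x) \<Rightarrow> 'x set \<Rightarrow>
   ((nat \<Rightarrow> 'x) \<times> real) measure" where
  "sample_law M P n X B =
     distr M (sample_space n \<Otimes>\<^sub>M unit_borel) (\<lambda>\<omega>. (sample_vector n X \<omega>, P B \<omega>))"

definition sample_past_field ::
  "'w measure \<Rightarrow> 'x::t2_space set set \<Rightarrow> ('x set \<Rightarrow> 'w \<Rightarrow> real) \<Rightarrow> nat \<Rightarrow> (nat \<Rightarrow> 'w \<Rightarrow> 'x) \<Rightarrow>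
   'x set \<Rightarrow> 'w measure" where
  "sample_past_field M \<A> P n X B =
     sigma (space M) (sets (past_field M \<A> P B) \<union>
       sets (vimage_algebra (space M) (sample_vector n X) (sample_space n)))"

text \<open>\<open>K\<close> is a (regular) version of the conditional distribution
  \<open>K x z1 \<Gamma>2 = \<P>[P\<^sub>B\<^sub>2 \<in> \<Gamma>2 | X = x, P\<^sub>B\<^sub>1 = z1]\<close>. Conditioning on the values of random elements
  means: composed with \<open>(X, P\<^sub>B\<^sub>1)\<close>, the kernel is a version of the conditional probability given
  \<open>\<sigma>(X, P\<^sub>B\<^sub>1)\<close>. Such a \<open>K\<close> exists because \<open>[0,1]\<close> is standard Borel, and it is unique up to
  null sets of \<^const>\<open>sample_law\<close>.\<close>

definition posterior_transition_kernel ::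
  "'w measure \<Rightarrow> ('x::t2_space set \<Rightarrow> 'w \<Rightarrow> real) \<Rightarrow> nat \<Rightarrow> (nat \<Rightarrow> 'w \<Rightarrow> 'x) \<Rightarrow> 'x set \<Rightarrow> 'x set \<Rightarrow>
   ((nat \<Rightarrow> 'x) \<Rightarrow> real \<Rightarrow> real measure) \<Rightarrow> bool" where
  "posterior_transition_kernel M P n X B1 B2 K \<longleftrightarrow>
     (\<lambda>(x, z). K x z) \<in> (sample_space n \<Otimes>\<^sub>M unit_borel) \<rightarrow>\<^sub>M prob_algebra unit_borel \<and>
     (\<forall>\<Gamma>2\<in>sets unit_borel. AE \<omega> in M.
        cond_probability M
          (vimage_algebra (space M) (\<lambda>\<omega>'. (sample_vector n X \<omega>', P B1 \<omega>'))
             (sample_space n \<Otimes>\<^sub>M unit_borel))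
          {\<omega>'\<in>space M. P B2 \<omega>' \<in> \<Gamma>2} \<omega> =
        measure (K (sample_vector n X \<omega>) (P B1 \<omega>)) \<Gamma>2)"

end

theory Submission
  imports Defs
begin

text \<open>Because the total mass is 1, additivity in distribution implies almost sure additivity of
  \<open>P\<close>. Hence \<open>P (A \<inter> B)\<close> is a function of the past of \<open>B\<close>, and \<open>P (A - B)\<close> of its future (the
  masses of the sets \<open>B \<union> A\<close> with \<open>A \<in> \<A>\<close>), up to null sets. Applying the Markov property along
  increasing sequences of sets shows that past and future of \<open>B\<close> are conditionally independent
  given \<open>P B\<close>. Given \<open>P\<close>, the probability that the observations in \<open>B\<close> hit sets \<open>A i\<close> and the
  remaining ones hit sets \<open>A j\<close> is a product of a past and a future factor. It follows that on
  each event specifying which observations lie in \<open>B\<close>, the posterior conditional expectation of a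
  future quantity is a function of \<open>P B\<close> and the observations outside \<open>B\<close>, which is the posterior
  Markov property. The Chapman-Kolmogorov equation is then the tower property.\<close>

section \<open>Conditional expectation and null sets\<close>

text \<open>Two obstacles shape the details. Additivity holds only outside null sets that depend on
  the sets involved, and the past of \<open>B\<close> is by definition generated by the masses of
  members of \<A> alone, without completion. So \<open>P (A \<inter> B)\<close> need not be
  measurable for it, nor even \<open>P B\<close>. Measurability is therefore claimed for fields
  enlarged by the events that agree almost surely with one of their own; this changes conditional
  expectations on null sets only, and no version of \<open>P\<close> with measures as paths has to
  be built. The second obstacle is that the mass \<open>P (A i)\<close> met by an observation is the
  sum of a past part \<open>P (A i \<inter> B)\<close> and a future part \<open>P (A i - B)\<close>,
  so the product over all observations belongs to neither side. Fixing which observations fall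
  outside \<open>B\<close> picks one of the 2^n terms of the expanded product, and that term
  factorises.\<close>

lemma set_integral_eq_sigma_sets:
  fixes f g :: "'a \<Rightarrow> real"
  assumes int: "integrable M f" "integrable M g"
    and N: "Int_stable N" "N \<subseteq> sets M" "space M \<in> N"
    and eq: "\<And>E. E \<in> N \<Longrightarrow> (\<integral>x\<in>E. f x \<partial>M) = (\<integral>x\<in>E. g x \<partial>M)"
    and E: "E \<in> sigma_sets (space M) N"
  shows "(\<integral>x\<in>E. f x \<partial>M) = (\<integral>x\<in>E. g x \<partial>M)"
proof -
  have Np: "N \<subseteq> Pow (space M)" using N(2) sets.sets_into_space by blast
  have sub: "sigma_sets (space M) N \<subseteq> sets M" by (simp add: N(2) sets.sigma_sets_subset)
  have si: "set_integrable M A f" "set_integrable M A g" if "A \<in> sets M" for A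
    unfolding set_integrable_def by (intro integrable_mult_indicator that int)+
  have c: "(\<integral>x\<in>space M - A. h x \<partial>M) = (\<integral>x\<in>space M. h x \<partial>M) - (\<integral>x\<in>A. h x \<partial>M)"
    if "A \<in> sets M" "integrable M h" for A and h :: "'a \<Rightarrow> real"
  proof -
    have hi: "set_integrable M B h" if "B \<in> sets M" for B
      unfolding set_integrable_def by (intro integrable_mult_indicator that \<open>integrable M h\<close>)
    have "space M = A \<union> (space M - A)" using sets.sets_into_space[OF that(1)] by auto
    then have "(\<integral>x\<in>space M. h x \<partial>M) = (\<integral>x\<in>A. h x \<partial>M) + (\<integral>x\<in>space M - A. h x \<partial>M)"
      using set_integral_Un[of A "space M - A" M h] hi that(1) by auto
    then show ?thesis by simp
  qed
  from N(1) Np E show ?thesis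
  proof (induction rule: sigma_sets_induct_disjoint)
    case (basic A) then show ?case by (rule eq)
  next
    case empty show ?case by (simp add: set_lebesgue_integral_def)
  next
    \<comment> \<open>The two total integrals agree because \<open>space M\<close> is among the test
      sets; subtracting the parts over \<open>A\<close> gives the complement.\<close>
    case (compl A)
    then have "A \<in> sets M" using sub by auto
    then show ?case using compl eq[OF N(3)] c int by simp
  next
    case (union A)
    have A: "\<And>i. A i \<in> sets M" "\<And>i j. i \<noteq> j \<Longrightarrow> A i \<inter> A j = {}"
      using subsetD[OF sub subsetD[OF union(2)]] union(1) by (auto simp: disjoint_family_on_def)
    have U: "\<Union>(range A) \<in> sets M" using A by auto
    show ?case
      using lebesgue_integral_countable_add[OF A si(1)[OF U]]
        lebesgue_integral_countable_add[OF A si(2)[OF U]] union by simp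
  qed
qed

section \<open>Sigma-fields enlarged by almost sure equality\<close>

definition null_augment :: "'a measure \<Rightarrow> 'a measure \<Rightarrow> 'a measure" where
  "null_augment M F =
     sigma (space M) {E \<in> sets M. \<exists>E'\<in>sets F. AE x in M. x \<in> E \<longleftrightarrow> x \<in> E'}"

lemma space_null_augment [simp]: "space (null_augment M F) = space M"
  by (simp add: null_augment_def space_measure_of_conv)

lemma sets_null_augment:
  assumes "subalgebra M F"
  shows "sets (null_augment M F) = {E \<in> sets M. \<exists>E'\<in>sets F. AE x in M. x \<in> E \<longleftrightarrow> x \<in> E'}"
    (is "_ = ?S")
proof -
  have sp: "space F = space M" and sub: "sets F \<subseteq> sets M" using assms by (auto simp: subalgebra_def)
  have "sigma_algebra (space M) ?S"
  proof (rule sigma_algebra_iff2[THEN iffD2], safe)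
    show "x \<in> space M" if "X \<in> sets M" "x \<in> X" for X x
      using that sets.sets_into_space by auto
    show "\<exists>E'\<in>sets F. AE x in M. x \<in> {} \<longleftrightarrow> x \<in> E'" by (intro bexI[of _ "{}"]) auto
  next
    fix s E' assume "E' \<in> sets F" "AE x in M. x \<in> s \<longleftrightarrow> x \<in> E'"
    then show "\<exists>E'\<in>sets F. AE x in M. x \<in> space M - s \<longleftrightarrow> x \<in> E'"
      by (intro bexI[of _ "space M - E'"]) (auto simp: sp[symmetric])
  next
    fix A :: "nat \<Rightarrow> 'a set" assume r: "range A \<subseteq> ?S"
    then have "\<forall>i. \<exists>E'\<in>sets F. AE x in M. x \<in> A i \<longleftrightarrow> x \<in> E'" by auto
    then obtain E where E: "\<And>i. E i \<in> sets F" "\<And>i. AE x in M. x \<in> A i \<longleftrightarrow> x \<in> E i"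
      by metis
    then have "AE x in M. \<forall>i. x \<in> A i \<longleftrightarrow> x \<in> E i" by (simp add: AE_all_countable)
    then show "\<exists>E'\<in>sets F. AE x in M. x \<in> \<Union>(range A) \<longleftrightarrow> x \<in> E'"
      using E(1) by (intro bexI[of _ "\<Union>(range E)"]) auto
    show "\<Union>(range A) \<in> sets M" using r by auto
  qed auto
  then show ?thesis
    by (simp add: null_augment_def sigma_algebra.sets_measure_of_eq)
qed

lemma subalgebra_null_augment: "subalgebra M F \<Longrightarrow> subalgebra M (null_augment M F)"
  by (auto simp: subalgebra_def[of M "null_augment M F"] sets_null_augment)

lemma null_augment_subalgebra: "subalgebra M F \<Longrightarrow> subalgebra (null_augment M F) F"
  by (auto simp: subalgebra_def[of "null_augment M F"] sets_null_augment) 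
     (auto simp: subalgebra_def)

text \<open>The device that turns an almost sure identity into measurability: preimages under
  \<open>f\<close> and \<open>g\<close> differ by a null set. \<open>f\<close> must be measurable
  for \<open>M\<close> itself, since the enlarged field contains events of \<open>M\<close>
  only.\<close>

lemma measurable_null_augment_AE:
  assumes F: "subalgebra M F" and f: "f \<in> measurable M N" and g: "g \<in> measurable (null_augment M F) N"
    and ae: "AE x in M. f x = g x"
  shows "f \<in> measurable (null_augment M F) N"
proof (rule measurableI)
  show "f x \<in> space N" if "x \<in> space (null_augment M F)" for x
    using f that by (auto dest: measurable_space)
next
  fix S assume S: "S \<in> sets N"
  have "g -` S \<inter> space M \<in> sets (null_augment M F)" using measurable_sets[OF g S] by simp
  then obtain E where E: "E \<in> sets F" "AE x in M. x \<in> g -` S \<inter> space M \<longleftrightarrow> x \<in> E"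
    by (auto simp: sets_null_augment[OF F])
  have "AE x in M. x \<in> f -` S \<inter> space M \<longleftrightarrow> x \<in> E" using E(2) ae by eventually_elim auto
  then show "f -` S \<inter> space (null_augment M F) \<in> sets (null_augment M F)"
    using E(1) measurable_sets[OF f S] by (auto simp: sets_null_augment[OF F])
qed

lemma null_augment_least:
  assumes F: "subalgebra M F" and G: "subalgebra M G"
    and sub: "sets F \<subseteq> sets (null_augment M G)"
  shows "sets (null_augment M F) \<subseteq> sets (null_augment M G)"
proof
  fix E assume "E \<in> sets (null_augment M F)"
  then obtain E' where E: "E \<in> sets M" "E' \<in> sets F" "AE x in M. x \<in> E \<longleftrightarrow> x \<in> E'"
    by (auto simp: sets_null_augment[OF F])
  with sub obtain E'' where "E'' \<in> sets G" "AE x in M. x \<in> E' \<longleftrightarrow> x \<in> E''"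
    by (auto simp: sets_null_augment[OF G])
  moreover from this E(3) have "AE x in M. x \<in> E \<longleftrightarrow> x \<in> E''" by auto
  ultimately show "E \<in> sets (null_augment M G)"
    using E(1) by (auto simp: sets_null_augment[OF G])
qed

lemma null_augment_mono:
  assumes "subalgebra M G" "subalgebra G F"
  shows "sets (null_augment M F) \<subseteq> sets (null_augment M G)"
proof (rule null_augment_least)
  show "subalgebra M F" using assms by (auto simp: subalgebra_def)
  show "sets F \<subseteq> sets (null_augment M G)"
    using assms(2) null_augment_subalgebra[OF assms(1)] by (auto simp: subalgebra_def)
qed fact

lemma set_integral_cong_AE_set:
  fixes f :: "'a \<Rightarrow> real"
  assumes "AE x in M. x \<in> E \<longleftrightarrow> x \<in> E'" "E \<in> sets M" "E' \<in> sets M" "f \<in> borel_measurable M"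
  shows "(\<integral>x\<in>E. f x \<partial>M) = (\<integral>x\<in>E'. f x \<partial>M)"
  unfolding set_lebesgue_integral_def
proof (rule integral_cong_AE)
  show "AE x in M. indicat_real E x *\<^sub>R f x = indicat_real E' x *\<^sub>R f x"
    using assms(1) by eventually_elim (auto simp: indicator_def)
qed (use assms in auto)

context prob_space
begin

lemma sigma_finite_subalgebraI: "subalgebra M F \<Longrightarrow> sigma_finite_subalgebra M F"
proof -
  assume "subalgebra M F"
  then interpret finite_measure_subalgebra M F
    by unfold_locales
  show ?thesis ..
qed

text \<open>A candidate \<open>g\<close> may be measurable for the enlarged field only. Both
  \<open>g\<close> and the usual version given \<open>F\<close> have the right integrals over events
  of \<open>F\<close>, hence over the enlarged field, where uniqueness of conditional expectation
  identifies them. Dynkin's theorem passes from \<open>N\<close> to \<open>F\<close>.\<close>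

lemma real_cond_exp_charact_generator:
  assumes F: "subalgebra M F" "sets F = sigma_sets (space M) N"
    and N: "Int_stable N" "space M \<in> N"
    and int: "integrable M f" "integrable M g" and g: "g \<in> borel_measurable (null_augment M F)"
    and eq: "\<And>E. E \<in> N \<Longrightarrow> (\<integral>x\<in>E. f x \<partial>M) = (\<integral>x\<in>E. g x \<partial>M)"
  shows "AE x in M. real_cond_exp M F f x = g x"
proof -
  interpret F: sigma_finite_subalgebra M F by (rule sigma_finite_subalgebraI[OF F(1)])
  interpret A: sigma_finite_subalgebra M "null_augment M F"
    by (rule sigma_finite_subalgebraI[OF subalgebra_null_augment[OF F(1)]])
  have FM: "sets F \<subseteq> sets M" using F(1) by (auto simp: subalgebra_def)
  \<comment> \<open>An event of the enlarged field and its twin in \<open>F\<close> give the same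
    integral, so testing on \<open>F\<close> suffices.\<close>
  have aug: "AE x in M. real_cond_exp M (null_augment M F) f x = h x"
    if h: "integrable M h" "h \<in> borel_measurable (null_augment M F)"
      and eqh: "\<And>E. E \<in> sets F \<Longrightarrow> (\<integral>x\<in>E. f x \<partial>M) = (\<integral>x\<in>E. h x \<partial>M)" for h
  proof (rule A.real_cond_exp_charact[OF _ int(1) h])
    fix E assume "E \<in> sets (null_augment M F)"
    then obtain E' where E: "E \<in> sets M" "E' \<in> sets F" "AE x in M. x \<in> E \<longleftrightarrow> x \<in> E'"
      by (auto simp: sets_null_augment[OF F(1)])
    have E': "E' \<in> sets M" using E FM by auto
    show "(\<integral>x\<in>E. f x \<partial>M) = (\<integral>x\<in>E. h x \<partial>M)"
      using eqh[OF E(2)] set_integral_cong_AE_set[OF E(3,1) E', of f]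
        set_integral_cong_AE_set[OF E(3,1) E', of h] int(1) h(1) by simp
  qed
  have "N \<subseteq> sets M" using FM F(2) by auto
  then have "AE x in M. real_cond_exp M (null_augment M F) f x = g x"
    using set_integral_eq_sigma_sets[OF int N(1) _ N(2) eq] F(2)
    by (intro aug int g) auto
  moreover have "AE x in M. real_cond_exp M (null_augment M F) f x = real_cond_exp M F f x"
    using int(1) F.real_cond_exp_intA null_augment_subalgebra[OF F(1)]
    by (intro aug F.real_cond_exp_int) (auto intro: measurable_from_subalg)
  ultimately show ?thesis by eventually_elim simp
qed

text \<open>The conditional expectation given the enlarged field is itself an admissible candidate
  for \<open>F\<close>: it is measurable up to null sets and averages correctly over the smaller
  family.\<close>

lemma real_cond_exp_null_augment:
  assumes F: "subalgebra M F" and f: "integrable M f"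
  shows "AE x in M. real_cond_exp M (null_augment M F) f x = real_cond_exp M F f x"
proof -
  interpret A: sigma_finite_subalgebra M "null_augment M F"
    by (rule sigma_finite_subalgebraI[OF subalgebra_null_augment[OF F]])
  have s: "sets F \<subseteq> sets (null_augment M F)" "space F = space M" 
    using F null_augment_subalgebra[OF F] by (auto simp: subalgebra_def)
  have "AE x in M. real_cond_exp M F f x = real_cond_exp M (null_augment M F) f x"
  proof (rule real_cond_exp_charact_generator[OF F, where N = "sets F"])
    show "sets F = sigma_sets (space M) (sets F)" using s(2) by (metis sets.sigma_sets_eq)
    show "space M \<in> sets F" using s(2) by (metis sets.top)
    show "Int_stable (sets F)" by (auto simp: Int_stable_def)
    show "(\<integral>x\<in>E. f x \<partial>M) = (\<integral>x\<in>E. real_cond_exp M (null_augment M F) f x \<partial>M)" if "E \<in> sets F" for E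
      using s that f by (intro A.real_cond_exp_intA) auto
  qed (use f A.real_cond_exp_int in auto)
  then show ?thesis by eventually_elim simp
qed


section \<open>Bounded test functions and conditional independence\<close>

lemma real_cond_exp_unit_interval:
  assumes F: "subalgebra M F" and u: "u \<in> borel_measurable M" "\<And>x. x \<in> space M \<Longrightarrow> u x \<in> {0..1}"
  shows "integrable M u" "AE x in M. real_cond_exp M F u x \<in> {0..1}"
proof -
  interpret F: sigma_finite_subalgebra M F by (rule sigma_finite_subalgebraI[OF F])
  show int: "integrable M u"
    by (rule integrable_const_bound[where B = 1]) (use u in auto)
  have "AE x in M. real_cond_exp M F u x \<ge> 0" "AE x in M. real_cond_exp M F u x \<le> 1"
    using u by (auto intro!: F.real_cond_exp_ge_c F.real_cond_exp_le_c int)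
  then show "AE x in M. real_cond_exp M F u x \<in> {0..1}" by eventually_elim simp
qed

text \<open>Test functions are kept in \<open>[0,1]\<close>, so that their products with integrable
  functions stay integrable. The bound is asked only almost surely, because conditional expectations
  satisfy it only in this sense.\<close>

lemma integrable_mult_unit_interval:
  fixes f g :: "'a \<Rightarrow> real"
  assumes f: "integrable M f" and g: "g \<in> borel_measurable M" "AE x in M. g x \<in> {0..1}"
  shows "integrable M (\<lambda>x. g x * f x)"
proof (rule Bochner_Integration.integrable_bound[OF f])
  show "AE x in M. norm (g x * f x) \<le> norm (f x)"
    using g(2) by eventually_elim (auto simp: abs_mult intro: mult_left_le_one_le)
qed (use f g in auto)

text \<open>Conditional independence of \<open>F\<close> and \<open>G\<close> given
  \<open>K\<close>, with \<open>K\<close> inside \<open>F\<close>. By self-adjointness of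
  conditional expectation the equation says that events of \<open>G\<close> have the same
  conditional probability given \<open>F\<close> as given \<open>K\<close>. In this form it is an
  equation between integrals over \<open>E\<close>, so Dynkin's theorem extends it from a generator
  of \<open>G\<close>.\<close>

definition cond_indep :: "'a measure \<Rightarrow> 'a measure \<Rightarrow> 'a measure \<Rightarrow> bool" where
  "cond_indep K F G \<longleftrightarrow> subalgebra M F \<and> subalgebra M G \<and> subalgebra F K \<and>
     (\<forall>D\<in>sets F. \<forall>E\<in>sets G.
        (\<integral>x\<in>E. indicator D x \<partial>M) = (\<integral>x\<in>E. real_cond_exp M K (indicator D) x \<partial>M))"

text \<open>Conditioning on \<open>K\<close> is self-adjoint: both integrals equal that of the
  product of the two conditional expectations. It moves an averaging from one factor to the
  other.\<close>

lemma real_cond_exp_integral_symmetric: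
  assumes K: "subalgebra M K"
    and u: "u \<in> borel_measurable M" "\<And>x. x \<in> space M \<Longrightarrow> u x \<in> {0..1}"
    and v: "integrable M v"
  shows "(\<integral>x. u x * real_cond_exp M K v x \<partial>M) = (\<integral>x. real_cond_exp M K u x * v x \<partial>M)"
    and "integrable M (\<lambda>x. real_cond_exp M K u x * v x)"
    and "integrable M (\<lambda>x. u x * real_cond_exp M K v x)"
proof -
  interpret K: sigma_finite_subalgebra M K by (rule sigma_finite_subalgebraI[OF K])
  note ub = real_cond_exp_unit_interval[OF K u]
  show 1: "integrable M (\<lambda>x. real_cond_exp M K u x * v x)"
    by (rule integrable_mult_unit_interval[OF v _ ub(2)]) simp
  show 2: "integrable M (\<lambda>x. u x * real_cond_exp M K v x)"
    by (rule integrable_mult_unit_interval[OF K.real_cond_exp_int(1)[OF v]]) (use u in auto)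
  have "(\<integral>x. u x * real_cond_exp M K v x \<partial>M) = (\<integral>x. real_cond_exp M K v x * real_cond_exp M K u x \<partial>M)"
    using 2 u by (subst K.real_cond_exp_intg(2)) (auto simp: mult.commute)
  also have "\<dots> = (\<integral>x. real_cond_exp M K u x * v x \<partial>M)"
    using 1 v by (subst K.real_cond_exp_intg(2)[symmetric]) (auto simp: mult.commute)
  finally show "(\<integral>x. u x * real_cond_exp M K v x \<partial>M) = (\<integral>x. real_cond_exp M K u x * v x \<partial>M)" .
qed

text \<open>The familiar form of conditional independence. By definition the indicator of
  \<open>D\<close> and its average given \<open>K\<close> have the same conditional expectation
  given \<open>G\<close>; integrating against the \<open>G\<close>-measurable \<open>v\<close> and
  moving the average onto \<open>v\<close> gives the defining identity on \<open>D\<close>.\<close>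

lemma cond_indep_cond_exp:
  assumes ci: "cond_indep K F G" and v: "integrable M v" "v \<in> borel_measurable G"
  shows "AE x in M. real_cond_exp M F v x = real_cond_exp M K v x"
proof -
  have sub: "subalgebra M F" "subalgebra M G" "subalgebra F K" "subalgebra M K"
    using ci by (auto simp: cond_indep_def subalgebra_def)
  interpret F: sigma_finite_subalgebra M F by (rule sigma_finite_subalgebraI[OF sub(1)])
  interpret G: sigma_finite_subalgebra M G by (rule sigma_finite_subalgebraI[OF sub(2)])
  interpret K: sigma_finite_subalgebra M K by (rule sigma_finite_subalgebraI[OF sub(4)])
  show ?thesis
  proof (rule F.real_cond_exp_charact[OF _ v(1)])
    fix D assume D: "D \<in> sets F"
    then have DM: "D \<in> sets M" using sub by (auto simp: subalgebra_def)
    let ?d = "indicat_real D"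
    have d: "?d \<in> borel_measurable M" "\<And>x. x \<in> space M \<Longrightarrow> ?d x \<in> {0..1}" using DM by (auto simp: indicator_def)
    note db = real_cond_exp_unit_interval[OF sub(4) d] and sy = real_cond_exp_integral_symmetric[OF sub(4) d v(1)]
    have "AE x in M. real_cond_exp M G ?d x = real_cond_exp M G (real_cond_exp M K ?d) x"
    proof (rule G.real_cond_exp_charact)
      fix E assume E: "E \<in> sets G"
      then have "(\<integral>x\<in>E. ?d x \<partial>M) = (\<integral>x\<in>E. real_cond_exp M K ?d x \<partial>M)"
        using ci D by (auto simp: cond_indep_def)
      also have "\<dots> = (\<integral>x\<in>E. real_cond_exp M G (real_cond_exp M K ?d) x \<partial>M)"
        by (rule G.real_cond_exp_intA[OF K.real_cond_exp_int(1)[OF db(1)] E])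
      finally show "(\<integral>x\<in>E. ?d x \<partial>M) = (\<integral>x\<in>E. real_cond_exp M G (real_cond_exp M K ?d) x \<partial>M)" .
    qed (use db K.real_cond_exp_int G.real_cond_exp_int in auto)
    then have "(\<integral>x. v x * real_cond_exp M G ?d x \<partial>M) =
        (\<integral>x. v x * real_cond_exp M G (real_cond_exp M K ?d) x \<partial>M)"
      using v(1) by (intro integral_cong_AE) auto
    moreover have "integrable M (\<lambda>x. v x * ?d x)"
      using integrable_mult_unit_interval[OF v(1) d(1)] d(2) by (auto simp: mult.commute)
    ultimately have "(\<integral>x. v x * ?d x \<partial>M) = (\<integral>x. v x * real_cond_exp M K ?d x \<partial>M)"
      using G.real_cond_exp_intg(2)[OF _ v(2) d(1)] sy(2)
        G.real_cond_exp_intg(2)[OF _ v(2), of "real_cond_exp M K ?d"] by (simp add: mult.commute)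
    then show "(\<integral>x\<in>D. v x \<partial>M) = (\<integral>x\<in>D. real_cond_exp M K v x \<partial>M)"
      using sy(1) by (simp add: set_lebesgue_integral_def mult.commute)
  qed (use v K.real_cond_exp_int sub in \<open>auto intro: measurable_from_subalg\<close>)
qed

text \<open>The form applied to samples: next to a future factor \<open>v\<close>, a past factor
  \<open>u\<close> may be averaged over the present. Replace \<open>v\<close> by its conditional
  expectation given \<open>F\<close>, which is that given \<open>K\<close>, and move the averaging
  to \<open>u\<close>.\<close>

lemma cond_indep_integral:
  assumes ci: "cond_indep K F G" and v: "integrable M v" "v \<in> borel_measurable G"
    and u: "u \<in> borel_measurable F" "\<And>x. x \<in> space M \<Longrightarrow> u x \<in> {0..1}"
  shows "(\<integral>x. u x * v x \<partial>M) = (\<integral>x. real_cond_exp M K u x * v x \<partial>M)"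
proof -
  have sub: "subalgebra M F" "subalgebra M K"
    using ci by (auto simp: cond_indep_def subalgebra_def)
  interpret F: sigma_finite_subalgebra M F by (rule sigma_finite_subalgebraI[OF sub(1)])
  have uM: "u \<in> borel_measurable M" using u(1) sub(1) by (rule measurable_from_subalg[rotated])
  have "integrable M (\<lambda>x. u x * v x)"
    using integrable_mult_unit_interval[OF v(1) uM] u(2) by auto
  then have "(\<integral>x. u x * v x \<partial>M) = (\<integral>x. u x * real_cond_exp M F v x \<partial>M)"
    using F.real_cond_exp_intg(2) u v by auto
  also have "\<dots> = (\<integral>x. u x * real_cond_exp M K v x \<partial>M)"
    using cond_indep_cond_exp[OF ci v] v uM by (intro integral_cong_AE) auto
  finally show ?thesis
    using real_cond_exp_integral_symmetric(1)[OF sub(2) uM u(2) v(1)] by simp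
qed

text \<open>The converse of \<open>cond_indep_cond_exp\<close>, with the hypothesis on an
  intersection-stable generator of \<open>G\<close>. Through it the Markov property, a statement on
  conditional probabilities, becomes conditional independence.\<close>

lemma cond_indepI:
  assumes sub: "subalgebra M F" "subalgebra M G" "subalgebra F K"
    and N: "sets G = sigma_sets (space M) N" "Int_stable N" "space M \<in> N"
    and eq: "\<And>E. E \<in> N \<Longrightarrow> AE x in M. real_cond_exp M F (indicator E) x = real_cond_exp M K (indicator E) x"
  shows "cond_indep K F G"
  unfolding cond_indep_def
proof (intro conjI sub ballI)
  fix D E assume D: "D \<in> sets F" and E: "E \<in> sets G"
  have K: "subalgebra M K" using sub by (auto simp: subalgebra_def)
  interpret F: sigma_finite_subalgebra M F by (rule sigma_finite_subalgebraI[OF sub(1)])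
  interpret K: sigma_finite_subalgebra M K by (rule sigma_finite_subalgebraI[OF K])
  have DM: "D \<in> sets M" using D sub by (auto simp: subalgebra_def)
  let ?d = "indicat_real D"
  have d: "?d \<in> borel_measurable M" "\<And>x. x \<in> space M \<Longrightarrow> ?d x \<in> {0..1}" using DM by (auto simp: indicator_def)
  have NM: "N \<subseteq> sets M" using sub(2) N(1) by (auto simp: subalgebra_def)
  have int: "integrable M ?d" using real_cond_exp_unit_interval(1)[OF K d] .
  show "(\<integral>x\<in>E. ?d x \<partial>M) = (\<integral>x\<in>E. real_cond_exp M K ?d x \<partial>M)"
  proof (rule set_integral_eq_sigma_sets[OF int _ N(2) NM N(3)])
    show "E \<in> sigma_sets (space M) N" using E N(1) by simp
    show "integrable M (real_cond_exp M K ?d)" using int by (rule K.real_cond_exp_int)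
    fix A assume A: "A \<in> N"
    then have AM: "A \<in> sets M" using NM by auto
    let ?a = "indicat_real A"
    have a: "integrable M ?a" using AM by (simp add: less_top[symmetric])
    have "(\<integral>x\<in>A. ?d x \<partial>M) = (\<integral>x\<in>D. ?a x \<partial>M)" by (simp add: set_lebesgue_integral_def mult.commute)
    also have "\<dots> = (\<integral>x\<in>D. real_cond_exp M F ?a x \<partial>M)" by (rule F.real_cond_exp_intA[OF a D])
    also have "\<dots> = (\<integral>x\<in>D. real_cond_exp M K ?a x \<partial>M)"
      unfolding set_lebesgue_integral_def using eq[OF A] DM by (intro integral_cong_AE) auto
    also have "\<dots> = (\<integral>x\<in>A. real_cond_exp M K ?d x \<partial>M)"
      using real_cond_exp_integral_symmetric(1)[OF K d a] by (simp add: set_lebesgue_integral_def mult.commute)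
    finally show "(\<integral>x\<in>A. ?d x \<partial>M) = (\<integral>x\<in>A. real_cond_exp M K ?d x \<partial>M)" .
  qed
qed

lemma cond_indep_null_augment:
  assumes ci: "cond_indep K F G"
  shows "cond_indep K F (null_augment M G)"
  unfolding cond_indep_def
proof (intro conjI ballI)
  show sub: "subalgebra M F" "subalgebra F K" and "subalgebra M (null_augment M G)"
    using ci by (auto simp: cond_indep_def subalgebra_null_augment)
  have G: "subalgebra M G" using ci by (auto simp: cond_indep_def)
  fix D E assume D: "D \<in> sets F" and "E \<in> sets (null_augment M G)"
  then obtain E' where E: "E \<in> sets M" "E' \<in> sets G" "AE x in M. x \<in> E \<longleftrightarrow> x \<in> E'"
    by (auto simp: sets_null_augment[OF G])
  then have "E' \<in> sets M" "D \<in> sets M" using G sub(1) D by (auto simp: subalgebra_def)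
  then have "(\<integral>x\<in>E. f x \<partial>M) = (\<integral>x\<in>E'. f x \<partial>M)" if "f \<in> borel_measurable M" for f :: "'a \<Rightarrow> real"
    using set_integral_cong_AE_set[OF E(3,1) _ that] by simp
  then show "(\<integral>x\<in>E. indicator D x \<partial>M) = (\<integral>x\<in>E. real_cond_exp M K (indicator D) x \<partial>M)"
    using ci D E(2) \<open>D \<in> sets M\<close> by (auto simp: cond_indep_def)
qed

lemma cond_indep_mono:
  assumes "cond_indep K F G" "sets G' \<subseteq> sets G" "space G' = space M"
  shows "cond_indep K F G'"
  using assms by (auto simp: cond_indep_def subalgebra_def)

text \<open>Independence at an earlier stage \<open>K\<close>, \<open>F\<close> and at a later stage
  \<open>K'\<close>, \<open>F'\<close> are joined. For \<open>E1 \<inter> E2\<close> condition on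
  the later past \<open>F'\<close> first: \<open>E1\<close> is known there, and \<open>E2\<close>
  turns into its conditional probability given \<open>K'\<close>. The resulting weight is measurable
  for \<open>G1\<close>, so the earlier independence applies to it, and the tower property removes
  \<open>F'\<close> again.\<close>

lemma cond_indep_chain:
  assumes c1: "cond_indep K F G1" and c2: "cond_indep K' F' G2"
    and sub: "subalgebra F' F" "subalgebra F' G1" "subalgebra G1 K'"
    and G: "subalgebra M G" "sets G = sigma_sets (space M) {E1 \<inter> E2 | E1 E2. E1 \<in> sets G1 \<and> E2 \<in> sets G2}"
  shows "cond_indep K F G"
proof (rule cond_indepI[OF _ G(1) _ G(2)])
  show FK: "subalgebra M F" "subalgebra F K" using c1 by (auto simp: cond_indep_def)
  have M: "subalgebra M F'" "subalgebra M K" "subalgebra M K'" "subalgebra M G1" "subalgebra M G2"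
    "subalgebra F' K"
    using c1 c2 sub FK by (auto simp: cond_indep_def subalgebra_def)
  have sp: "space M \<in> sets G1" "space M \<in> sets G2" using M by (metis sets.top subalgebra_def)+
  then show "space M \<in> {E1 \<inter> E2 | E1 E2. E1 \<in> sets G1 \<and> E2 \<in> sets G2}" by blast
  show "Int_stable {E1 \<inter> E2 | E1 E2. E1 \<in> sets G1 \<and> E2 \<in> sets G2}"
  proof (rule Int_stableI, clarify)
    fix a b c d assume "a \<in> sets G1" "b \<in> sets G2" "c \<in> sets G1" "d \<in> sets G2"
    then show "\<exists>E1 E2. a \<inter> b \<inter> (c \<inter> d) = E1 \<inter> E2 \<and> E1 \<in> sets G1 \<and> E2 \<in> sets G2"
      by (intro exI[of _ "a \<inter> c"] exI[of _ "b \<inter> d"]) auto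
  qed
  interpret F: sigma_finite_subalgebra M F by (rule sigma_finite_subalgebraI[OF FK(1)])
  interpret K: sigma_finite_subalgebra M K by (rule sigma_finite_subalgebraI[OF M(2)])
  interpret F': sigma_finite_subalgebra M F' by (rule sigma_finite_subalgebraI[OF M(1)])
  interpret K': sigma_finite_subalgebra M K' by (rule sigma_finite_subalgebraI[OF M(3)])
  fix E assume "E \<in> {E1 \<inter> E2 | E1 E2. E1 \<in> sets G1 \<and> E2 \<in> sets G2}"
  then obtain E1 E2 where E: "E = E1 \<inter> E2" "E1 \<in> sets G1" "E2 \<in> sets G2" by auto
  then have EM: "E1 \<in> sets M" "E2 \<in> sets M" "E1 \<in> sets F'" using M sub by (auto simp: subalgebra_def)
  let ?v = "\<lambda>x. indicat_real E1 x * indicat_real E2 x"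
  let ?w = "\<lambda>x. indicat_real E1 x * real_cond_exp M K' (indicator E2) x"
  have i2: "integrable M (indicat_real E2)" using EM by (simp add: less_top[symmetric])
  have iv: "integrable M ?v"
    by (rule integrable_mult_unit_interval[OF i2]) (use EM in \<open>auto simp: indicator_def\<close>)
  have iw: "integrable M ?w"
    by (rule integrable_mult_unit_interval[OF K'.real_cond_exp_int(1)[OF i2]])
      (use EM in \<open>auto simp: indicator_def\<close>)
  \<comment> \<open>Here \<open>K'\<close> has to lie in \<open>G1\<close>: the projected factor
    stays within reach of \<open>c1\<close>.\<close>
  have "real_cond_exp M K' (indicat_real E2) \<in> borel_measurable G1"
    by (rule measurable_from_subalg[OF sub(3)]) simp
  then have wm: "?w \<in> borel_measurable G1" using E(2) by measurable
  have "AE x in M. real_cond_exp M F' ?v x = indicator E1 x * real_cond_exp M F' (indicator E2) x"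
    using EM by (intro F'.real_cond_exp_mult iv) auto
  moreover have "AE x in M. real_cond_exp M F' (indicator E2) x = real_cond_exp M K' (indicator E2) x"
    using E(3) by (intro cond_indep_cond_exp[OF c2] i2) auto
  ultimately have F'v: "AE x in M. real_cond_exp M F' ?v x = ?w x" by eventually_elim simp
  have FF': "AE x in M. real_cond_exp M F (real_cond_exp M F' ?v) x = real_cond_exp M F ?v x"
    by (rule F.real_cond_exp_nested_subalg[OF M(1) sub(1) iv])
  have KF': "AE x in M. real_cond_exp M K (real_cond_exp M F' ?v) x = real_cond_exp M K ?v x"
    by (rule K.real_cond_exp_nested_subalg[OF M(1) M(6) iv])
  have "AE x in M. real_cond_exp M F (real_cond_exp M F' ?v) x = real_cond_exp M F ?w x"
    using iw by (intro F.real_cond_exp_cong F'v) auto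
  moreover have "AE x in M. real_cond_exp M K (real_cond_exp M F' ?v) x = real_cond_exp M K ?w x"
    using iw by (intro K.real_cond_exp_cong F'v) auto
  moreover have "AE x in M. real_cond_exp M F ?w x = real_cond_exp M K ?w x"
    by (rule cond_indep_cond_exp[OF c1 iw wm])
  ultimately have "AE x in M. real_cond_exp M F ?v x = real_cond_exp M K ?v x"
    using FF' KF' by eventually_elim simp
  moreover have "indicator E = ?v" by (auto simp: E(1) indicator_def fun_eq_iff)
  ultimately show "AE x in M. real_cond_exp M F (indicator E) x = real_cond_exp M K (indicator E) x" by simp
qed

end

section \<open>Random probability measures\<close>

lemma space_generated_field [simp]: "space (generated_field M P \<C>) = space M"
  by (simp add: generated_field_def space_measure_of_conv)

lemma sets_generated_field:
  "sets (generated_field M P \<C>) =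
     sigma_sets (space M) {P A -` S \<inter> space M | A S. A \<in> \<C> \<and> S \<in> sets unit_borel}"
  unfolding generated_field_def by (rule sets_measure_of) auto

lemma generated_field_least:
  assumes "space N = space M" "\<And>A. A \<in> \<C> \<Longrightarrow> P A \<in> N \<rightarrow>\<^sub>M unit_borel"
  shows "sets (generated_field M P \<C>) \<subseteq> sets N"
proof -
  have "{P A -` S \<inter> space M | A S. A \<in> \<C> \<and> S \<in> sets unit_borel} \<subseteq> sets N"
  proof clarify
    fix A S assume "A \<in> \<C>" "S \<in> sets unit_borel"
    from measurable_sets[OF assms(2)[OF this(1)] this(2)]
    show "P A -` S \<inter> space M \<in> sets N" unfolding assms(1) .
  qed
  from sets.sigma_sets_subset[OF this] show ?thesis
    unfolding sets_generated_field assms(1) .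
qed

lemma measurable_unit_borelI:
  fixes f :: "'a \<Rightarrow> real"
  assumes "f \<in> borel_measurable N" "\<And>x. x \<in> space N \<Longrightarrow> f x \<in> {0..1}"
  shows "f \<in> N \<rightarrow>\<^sub>M unit_borel"
proof (rule measurable_restrict_space2[OF _ assms(1)])
  show "f \<in> space N \<rightarrow> {0..1}" using assms(2) by (rule funcsetI)
qed

locale random_probability = prob_space M for M :: "'w measure" +
  fixes P :: "'x::t2_space set \<Rightarrow> 'w \<Rightarrow> real"
  assumes rpm: "random_probability_measure M P"
begin

section \<open>Almost sure additivity of the masses\<close>

lemma measurable_P: "A \<in> sets borel \<Longrightarrow> P A \<in> M \<rightarrow>\<^sub>M unit_borel"
  by (rule rpm[unfolded random_probability_measure_def, THEN conjunct1, rule_format])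

lemma borel_measurable_P: "A \<in> sets borel \<Longrightarrow> P A \<in> borel_measurable M"
  by (rule measurable_restrict_space2_iff[THEN iffD1, THEN conjunct1, OF measurable_P])

lemma P_unit_interval: "A \<in> sets borel \<Longrightarrow> \<omega> \<in> space M \<Longrightarrow> P A \<omega> \<in> {0..1}"
  using measurable_space[OF measurable_P, of A \<omega>] unfolding space_restrict_space by blast

lemma P_UNIV: "AE \<omega> in M. P UNIV \<omega> = 1"
  by (rule rpm[unfolded random_probability_measure_def, THEN conjunct2, THEN conjunct2, THEN conjunct1])

lemma P_continuous:
  "(\<And>n. A n \<in> sets borel) \<Longrightarrow> decseq A \<Longrightarrow> (\<Inter>n. A n) = {} \<Longrightarrow>
     AE \<omega> in M. (\<lambda>n::nat. P (A n) \<omega>) \<longlonglongrightarrow> 0"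
  by (rule rpm[unfolded random_probability_measure_def, THEN conjunct2, THEN conjunct2, THEN conjunct2,
        rule_format]) blast

text \<open>Additivity in distribution forces almost sure additivity because the total mass is
  the constant 1: the masses of a partition of the whole space sum to 1 almost surely.\<close>

lemma P_partition:
  assumes A: "A \<in> sets borel" "B \<in> sets borel" "C \<in> sets borel"
    and d: "A \<inter> B = {}" "A \<inter> C = {}" "B \<inter> C = {}" and U: "A \<union> B \<union> C = UNIV"
  shows "AE \<omega> in M. P A \<omega> + P B \<omega> + P C \<omega> = 1"
proof -
  define T where "T j = (if j = 1 then A else if j = 2 then B else C)" for j :: nat
  \<comment> \<open>One cut point, \<open>i 1 = 3\<close>: block 0 is \<open>{1..3}\<close>, the
    whole partition, and block 1 is \<open>{4..3}\<close>, hence empty. Only coordinate 0 is read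
    off.\<close>
  define i :: "nat \<Rightarrow> nat" where "i l = (if l = 0 then 0 else 3)" for l
  let ?N = "\<Pi>\<^sub>M l\<in>{0..1::nat}. (borel :: real measure)"
  let ?X = "\<lambda>\<omega>. \<lambda>l\<in>{0..1}. P (\<Union>j\<in>{i l + 1..i (l + 1)}. T j) \<omega>"
  let ?Y = "\<lambda>\<omega>. \<lambda>l\<in>{0..1}. \<Sum>j\<in>{i l + 1..i (l + 1)}. P (T j) \<omega>"
  have T: "T j \<in> sets borel" for j using A by (simp add: T_def)
  have set3: "{Suc 0..3} = {1, 2, 3}" by auto
  have dist: "distr M ?N ?X = distr M ?N ?Y"
  proof -
    have "disjoint_family_on T {1..3}"
      using d by (auto simp: disjoint_family_on_def T_def)
    then show ?thesis
      using rpm[unfolded random_probability_measure_def, THEN conjunct2, THEN conjunct1,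
          rule_format, of 1 3 T i] T by (simp add: i_def strict_mono_on_def)
  qed
  have X: "?X \<in> M \<rightarrow>\<^sub>M ?N" and Y: "?Y \<in> M \<rightarrow>\<^sub>M ?N"
    by (intro measurable_restrict borel_measurable_sum borel_measurable_P sets.finite_UN T finite_atLeastAtMost)+
  have S: "{f \<in> space ?N. f 0 = 1} \<in> sets ?N"
    by measurable
  have U': "(\<Union>j\<in>{Suc 0..3}. T j) = UNIV" unfolding set3 using U by (auto simp add: T_def)
  have "AE \<omega> in M. ?X \<omega> 0 = 1" using P_UNIV by (simp add: i_def U')
  then have "AE f in distr M ?N ?X. f 0 = 1" by (subst AE_distr_iff[OF X S]) 
  then have "AE \<omega> in M. ?Y \<omega> 0 = 1"
    unfolding dist by (subst (asm) AE_distr_iff[OF Y S])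
  then show ?thesis by (simp add: i_def set3 T_def add.assoc)
qed

lemma P_empty: "AE \<omega> in M. P {} \<omega> = 0"
proof -
  have "AE \<omega> in M. P {} \<omega> + P {} \<omega> + P UNIV \<omega> = 1" by (rule P_partition) auto
  with P_UNIV show ?thesis by eventually_elim simp
qed

text \<open>Compare two partitions of the whole space: \<open>A\<close>, \<open>B\<close>, rest and
  \<open>A \<union> B\<close>, \<open>{}\<close>, rest. The masses of both sum to 1, and the rest
  cancels.\<close>

lemma P_Un:
  assumes "A \<in> sets borel" "B \<in> sets borel" "A \<inter> B = {}"
  shows "AE \<omega> in M. P (A \<union> B) \<omega> = P A \<omega> + P B \<omega>"
proof -
  have "AE \<omega> in M. P A \<omega> + P B \<omega> + P (- (A \<union> B)) \<omega> = 1"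
    by (rule P_partition) (use assms in auto)
  moreover have "AE \<omega> in M. P (A \<union> B) \<omega> + P {} \<omega> + P (- (A \<union> B)) \<omega> = 1"
    by (rule P_partition) (use assms in auto)
  ultimately show ?thesis using P_empty by eventually_elim simp
qed

text \<open>Nonempty members of \<A> always meet, so this is the form of additivity that
  inclusion-exclusion uses. Both \<open>A \<union> B\<close> and \<open>B\<close> are cut along
  \<open>B - A\<close>.\<close>

lemma P_modular:
  assumes [measurable]: "A \<in> sets borel" "B \<in> sets borel"
  shows "AE \<omega> in M. P (A \<union> B) \<omega> + P (A \<inter> B) \<omega> = P A \<omega> + P B \<omega>"
proof -
  have "AE \<omega> in M. P (A \<union> (B - A)) \<omega> = P A \<omega> + P (B - A) \<omega>"
    by (rule P_Un) auto
  moreover have "AE \<omega> in M. P ((A \<inter> B) \<union> (B - A)) \<omega> = P (A \<inter> B) \<omega> + P (B - A) \<omega>"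
    by (rule P_Un) auto
  moreover have "(A \<inter> B) \<union> (B - A) = B" "A \<union> (B - A) = A \<union> B" by auto
  ultimately show ?thesis by auto
qed

lemma P_lessThan_UN:
  fixes A :: "nat \<Rightarrow> 'x set"
  assumes A: "\<And>i. A i \<in> sets borel" and d: "disjoint_family A"
  shows "AE \<omega> in M. P (\<Union>i<n. A i) \<omega> = (\<Sum>i<n. P (A i) \<omega>)"
proof (induction n)
  case 0 then show ?case using P_empty by simp
next
  case (Suc n)
  have "AE \<omega> in M. P ((\<Union>i<n. A i) \<union> A n) \<omega> = P (\<Union>i<n. A i) \<omega> + P (A n) \<omega>"
  proof (rule P_Un)
    show "(\<Union>i<n. A i) \<inter> A n = {}"
      using disjoint_family_onD[OF d] by (metis (no_types, lifting) UN_extend_simps(4) UNIV_I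
        SUP_bot_conv(2) lessThan_iff less_irrefl)
  qed (use A in auto)
  with Suc show ?case by (auto simp: lessThan_Suc Un_commute)
qed

text \<open>Continuity is assumed only along sequences decreasing to the empty set. The tails of a
  disjoint family are such a sequence, since a point lies in at most one member, and a partial sum
  differs from the total mass by the mass of a tail.\<close>

lemma P_countable:
  fixes A :: "nat \<Rightarrow> 'x set"
  assumes A: "\<And>i. A i \<in> sets borel" and d: "disjoint_family A"
  shows "AE \<omega> in M. (\<lambda>n. \<Sum>i<n. P (A i) \<omega>) \<longlonglongrightarrow> P (\<Union>i. A i) \<omega>"
proof -
  have eq: "AE \<omega> in M. P (\<Union>i. A i) \<omega> = (\<Sum>i<n. P (A i) \<omega>) + P (\<Union>i\<in>{n..}. A i) \<omega>" for n
  proof -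
    have "AE \<omega> in M. P ((\<Union>i<n. A i) \<union> (\<Union>i\<in>{n..}. A i)) \<omega> = P (\<Union>i<n. A i) \<omega> + P (\<Union>i\<in>{n..}. A i) \<omega>"
    proof (rule P_Un)
      have "A i \<inter> A j = {}" if "i < n" "n \<le> j" for i j
        using disjoint_family_onD[OF d, of i j] that by auto
      then show "(\<Union>i<n. A i) \<inter> (\<Union>i\<in>{n..}. A i) = {}" by (auto simp: disjoint_iff)
    qed (use A in auto)
    moreover have "(\<Union>i<n. A i) \<union> (\<Union>i\<in>{n..}. A i) = (\<Union>i. A i)"
      unfolding UN_Un[symmetric] by (rule arg_cong[where f = "\<lambda>I. \<Union>(A ` I)"]) auto
    ultimately show ?thesis using P_lessThan_UN[OF A d, of n] by auto
  qed
  have "AE \<omega> in M. (\<lambda>n. P (\<Union>i\<in>{n..}. A i) \<omega>) \<longlonglongrightarrow> 0"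
  proof (rule P_continuous)
    show "decseq (\<lambda>n. \<Union>i\<in>{n..}. A i)" unfolding decseq_def by (intro allI impI UN_mono) auto
    have False if x: "\<forall>n. x \<in> (\<Union>i\<in>{n..}. A i)" for x
    proof -
      obtain i where "x \<in> A i" using x by blast
      moreover obtain j where "j \<ge> Suc i" "x \<in> A j" using x[rule_format, of "Suc i"] by auto
      ultimately show False using disjoint_family_onD[OF d, of i j] by auto
    qed
    then show "(\<Inter>n. \<Union>i\<in>{n..}. A i) = {}" by blast
  qed (use A in auto)
  moreover have "AE \<omega> in M. \<forall>n. P (\<Union>i. A i) \<omega> = (\<Sum>i<n. P (A i) \<omega>) + P (\<Union>i\<in>{n..}. A i) \<omega>"
    using eq by (simp add: AE_all_countable)
  ultimately show ?thesis
  proof eventually_elim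
    case (elim \<omega>)
    have "(\<lambda>n. P (\<Union>i. A i) \<omega> - P (\<Union>i\<in>{n..}. A i) \<omega>) \<longlonglongrightarrow> P (\<Union>i. A i) \<omega> - 0"
      by (intro tendsto_intros elim)
    moreover have "(\<lambda>n. P (\<Union>i. A i) \<omega> - P (\<Union>i\<in>{n..}. A i) \<omega>) = (\<lambda>n. \<Sum>i<n. P (A i) \<omega>)"
      using elim(2) by (intro ext) (metis add_diff_cancel_right')
    ultimately show ?case by simp
  qed
qed

section \<open>Fields generated by masses\<close>

lemma subalgebra_generated_field:
  assumes "\<C> \<subseteq> sets borel"
  shows "subalgebra M (generated_field M P \<C>)"
proof -
  have "sets (generated_field M P \<C>) \<subseteq> sets M"
  proof (rule generated_field_least)
    fix A assume "A \<in> \<C>"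
    with assms have "A \<in> sets borel" by (rule subsetD)
    then show "P A \<in> M \<rightarrow>\<^sub>M unit_borel" by (rule measurable_P)
  qed (rule refl)
  then show ?thesis by (simp add: subalgebra_def)
qed

lemma measurable_generated_field:
  assumes "A \<in> \<C>" "\<C> \<subseteq> sets borel"
  shows "P A \<in> generated_field M P \<C> \<rightarrow>\<^sub>M unit_borel"
proof (rule measurableI)
  show "P A \<omega> \<in> space unit_borel" if "\<omega> \<in> space (generated_field M P \<C>)" for \<omega>
    using P_unit_interval[of A \<omega>] assms that by (auto simp: space_restrict_space)
next
  fix S assume "S \<in> sets unit_borel"
  then have "P A -` S \<inter> space M \<in> {P A -` S \<inter> space M | A S. A \<in> \<C> \<and> S \<in> sets unit_borel}"
    using assms(1) by blast
  then show "P A -` S \<inter> space (generated_field M P \<C>) \<in> sets (generated_field M P \<C>)"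
    unfolding sets_generated_field by (simp only: space_generated_field sigma_sets.Basic)
qed

lemma borel_measurable_generated_field:
  assumes "A \<in> \<C>" "\<C> \<subseteq> sets borel"
  shows "P A \<in> borel_measurable (generated_field M P \<C>)"
  by (rule measurable_restrict_space2_iff[THEN iffD1, THEN conjunct1, OF measurable_generated_field[OF assms]])

lemma measurable_null_augment_generated_field:
  assumes "A \<in> \<C>" "\<C> \<subseteq> sets borel"
  shows "P A \<in> borel_measurable (null_augment M (generated_field M P \<C>))"
  by (rule measurable_from_subalg[OF null_augment_subalgebra[OF subalgebra_generated_field[OF assms(2)]]
        borel_measurable_generated_field[OF assms]])

lemma generated_field_subset_null_augment:
  assumes "\<C> \<subseteq> sets borel" "\<And>A. A \<in> \<C> \<Longrightarrow> P A \<in> borel_measurable (null_augment M F)"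
  shows "sets (generated_field M P \<C>) \<subseteq> sets (null_augment M F)"
proof (rule generated_field_least)
  fix A assume A: "A \<in> \<C>"
  then have "A \<in> sets borel" using assms(1) by blast
  from P_unit_interval[OF this] show "P A \<in> null_augment M F \<rightarrow>\<^sub>M unit_borel"
    by (intro measurable_unit_borelI assms(2) A) simp
qed simp

lemma generated_field_mono:
  assumes "\<C> \<subseteq> \<D>" "\<D> \<subseteq> sets borel"
  shows "subalgebra (generated_field M P \<D>) (generated_field M P \<C>)"
proof -
  have "sets (generated_field M P \<C>) \<subseteq> sets (generated_field M P \<D>)"
  proof (rule generated_field_least)
    fix A assume "A \<in> \<C>"
    then have "A \<in> \<D>" using assms(1) by blast
    then show "P A \<in> generated_field M P \<D> \<rightarrow>\<^sub>M unit_borel" by (rule measurable_generated_field[OF _ assms(2)])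
  qed simp
  then show ?thesis by (simp add: subalgebra_def)
qed

text \<open>Dynkin's theorem in \<open>A\<close> with the trace set \<open>C\<close> fixed.
  Complements are taken inside \<open>C\<close>, whose mass is available since
  \<open>UNIV \<in> N\<close>; disjoint unions use countable additivity. Both identities hold only
  almost surely, which forces the enlarged field. The lemma serves the past of \<open>B\<close> with
  \<open>C = B\<close> and its future with \<open>C = - B\<close>.\<close>

lemma P_trace_measurable:
  assumes F: "subalgebra M F" and N: "Int_stable N" "UNIV \<in> N" "sets borel = sigma_sets UNIV N"
    and C: "C \<in> sets borel"
    and P: "\<And>A. A \<in> N \<Longrightarrow> P (A \<inter> C) \<in> borel_measurable (null_augment M F)"
    and A: "A \<in> sets borel"
  shows "P (A \<inter> C) \<in> borel_measurable (null_augment M F)"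
proof -
  have "N \<subseteq> Pow UNIV" "A \<in> sigma_sets UNIV N" using A N(3) by simp_all
  with N(1) show ?thesis
  proof (induction rule: sigma_sets_induct_disjoint)
    case (basic A) then show ?case by (rule P)
  next
    case empty
    show ?case
      by (rule measurable_null_augment_AE[OF F borel_measurable_P, where g = "\<lambda>_. 0"])
        (simp_all add: P_empty)
  next
    case (compl A)
    have A: "A \<in> sets borel" using compl N(3) by simp
    have "AE \<omega> in M. P ((A \<inter> C) \<union> ((UNIV - A) \<inter> C)) \<omega> = P (A \<inter> C) \<omega> + P ((UNIV - A) \<inter> C) \<omega>"
      by (rule P_Un) (use A C in auto)
    moreover have "(A \<inter> C) \<union> ((UNIV - A) \<inter> C) = C" by auto
    ultimately have *: "AE \<omega> in M. P ((UNIV - A) \<inter> C) \<omega> = P C \<omega> - P (A \<inter> C) \<omega>" by auto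
    have "P C \<in> borel_measurable (null_augment M F)" using P[OF N(2)] by simp
    with A C compl(2) show ?case
      by (intro measurable_null_augment_AE[OF F borel_measurable_P borel_measurable_diff *]) simp_all
  next
    case (union A)
    have A: "A i \<in> sets borel" for i unfolding N(3) using union(2) by (rule subsetD) (rule rangeI)
    have "AE \<omega> in M. (\<lambda>n. \<Sum>i<n. P (A i \<inter> C) \<omega>) \<longlonglongrightarrow> P (\<Union>i. A i \<inter> C) \<omega>"
    proof (rule P_countable)
      show "disjoint_family (\<lambda>i. A i \<inter> C)" using union(1) by (auto simp: disjoint_family_on_def)
    qed (intro sets.Int A C)
    \<comment> \<open>\<open>lim\<close> is defined everywhere and measurable, and it agrees with
      the mass wherever the sums converge to it.\<close>
    then have *: "AE \<omega> in M. P (\<Union>i. A i \<inter> C) \<omega> = lim (\<lambda>n. \<Sum>i<n. P (A i \<inter> C) \<omega>)"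
      by eventually_elim (simp add: limI)
    have "P (\<Union>i. A i \<inter> C) \<in> borel_measurable (null_augment M F)"
    proof (rule measurable_null_augment_AE[OF F borel_measurable_P _ *])
      show "(\<lambda>\<omega>. lim (\<lambda>n. \<Sum>i<n. P (A i \<inter> C) \<omega>)) \<in> borel_measurable (null_augment M F)"
        by (intro borel_measurable_lim_metric borel_measurable_sum union(3))
    qed (use A C in auto)
    moreover have "(\<Union>i. A i \<inter> C) = \<Union>(range A) \<inter> C" by auto
    ultimately show ?case by simp
  qed
qed

end

section \<open>Finite unions and the past of a set\<close>

lemma finite_unions_Un:
  assumes "A \<in> finite_unions \<A>" "B \<in> finite_unions \<A>"
  shows "A \<union> B \<in> finite_unions \<A>"
proof -
  obtain F G where "A = \<Union>F" "finite F" "F \<subseteq> \<A>" "B = \<Union>G" "finite G" "G \<subseteq> \<A>"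
    using assms by (auto simp: finite_unions_def)
  then show ?thesis unfolding finite_unions_def by (intro CollectI exI[of _ "F \<union> G"]) auto
qed

lemma in_finite_unions: "A \<in> \<A> \<Longrightarrow> A \<in> finite_unions \<A>"
  unfolding finite_unions_def by (intro CollectI exI[of _ "{A}"]) auto

locale indexed_random_probability = random_probability M P
  for M :: "'w measure" and P :: "'x::t2_space set \<Rightarrow> 'w \<Rightarrow> real" +
  fixes \<A> :: "'x set set"
  assumes indexing: "indexing_collection \<A>"
begin

lemma indexing_empty: "{} \<in> \<A>" and indexing_UNIV: "UNIV \<in> \<A>"
  and indexing_sets: "sets borel = sigma_sets UNIV \<A>"
  using indexing by (auto simp: indexing_collection_def)

lemma indexing_Int: "A \<in> \<A> \<Longrightarrow> B \<in> \<A> \<Longrightarrow> A \<inter> B \<in> \<A>"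
proof -
  have "\<forall>\<S>. \<S> \<subseteq> \<A> \<and> \<S> \<noteq> {} \<longrightarrow> \<Inter>\<S> \<in> \<A>" using indexing by (simp add: indexing_collection_def)
  from this[rule_format, of "{A, B}"] show "A \<in> \<A> \<Longrightarrow> B \<in> \<A> \<Longrightarrow> A \<inter> B \<in> \<A>" by simp
qed

lemma indexing_borel: "\<A> \<subseteq> sets borel"
  unfolding indexing_sets by auto

lemma finite_unions_borel: "B \<in> finite_unions \<A> \<Longrightarrow> B \<in> sets borel"
  using indexing_borel by (auto simp: finite_unions_def intro!: sets.finite_Union)

abbreviation past :: "'x set \<Rightarrow> 'w measure" where
  "past B \<equiv> null_augment M (past_field M \<A> P B)"

lemma subalgebra_past_field: "subalgebra M (past_field M \<A> P B)"
  unfolding past_field_def using indexing_borel by (intro subalgebra_generated_field) auto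

lemma subalgebra_past: "subalgebra M (past B)"
  by (intro subalgebra_null_augment subalgebra_past_field)

lemma subalgebra_past_mono: "B \<subseteq> C \<Longrightarrow> subalgebra (past C) (past B)"
proof -
  assume "B \<subseteq> C"
  then have "subalgebra (past_field M \<A> P C) (past_field M \<A> P B)"
    unfolding past_field_def using indexing_borel by (intro generated_field_mono) auto
  from null_augment_mono[OF subalgebra_past_field this] show ?thesis
    by (simp add: subalgebra_def)
qed

lemma P_past_indexing: "A \<in> \<A> \<Longrightarrow> A \<subseteq> B \<Longrightarrow> P A \<in> borel_measurable (past B)"
  unfolding past_field_def
  by (rule measurable_null_augment_generated_field) (use indexing_borel in auto)

text \<open>Inclusion-exclusion by induction on the number of sets. The correction term intersects
  with the new set, so the induction must carry an arbitrary \<open>A0\<close>; closure under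
  intersection keeps \<open>A0 \<inter> A\<close> in \<A>, and it lies in \<open>B\<close>.\<close>

lemma P_past_Int_Union:
  assumes "finite \<F>" "\<F> \<subseteq> \<A>" "A0 \<in> \<A>" "A0 \<inter> \<Union>\<F> \<subseteq> B"
  shows "P (A0 \<inter> \<Union>\<F>) \<in> borel_measurable (past B)"
  using assms
proof (induction \<F> arbitrary: A0 rule: finite_induct)
  case empty
  then show ?case using P_past_indexing[OF indexing_empty] by simp
next
  case (insert A \<F>)
  have [simp]: "A0 \<in> sets borel" "A \<in> sets borel" "A0 \<inter> A \<in> \<A>" "\<Union>\<F> \<in> sets borel"
    using insert indexing_borel indexing_Int by (auto intro!: sets.finite_Union)
  have "AE \<omega> in M. P (A0 \<inter> A \<union> A0 \<inter> \<Union>\<F>) \<omega> + P ((A0 \<inter> A) \<inter> (A0 \<inter> \<Union>\<F>)) \<omega> = P (A0 \<inter> A) \<omega> + P (A0 \<inter> \<Union>\<F>) \<omega>"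
    by (rule P_modular) auto
  moreover have "A0 \<inter> A \<union> A0 \<inter> \<Union>\<F> = A0 \<inter> \<Union>(insert A \<F>)" "(A0 \<inter> A) \<inter> (A0 \<inter> \<Union>\<F>) = (A0 \<inter> A) \<inter> \<Union>\<F>"
    by auto
  ultimately have *: "AE \<omega> in M. P (A0 \<inter> \<Union>(insert A \<F>)) \<omega> =
      P (A0 \<inter> A) \<omega> + P (A0 \<inter> \<Union>\<F>) \<omega> - P ((A0 \<inter> A) \<inter> \<Union>\<F>) \<omega>" by auto
  have "P (A0 \<inter> A) \<in> borel_measurable (past B)" "P (A0 \<inter> \<Union>\<F>) \<in> borel_measurable (past B)"
    "P ((A0 \<inter> A) \<inter> \<Union>\<F>) \<in> borel_measurable (past B)"
    using insert by (auto intro!: P_past_indexing[OF \<open>A0 \<inter> A \<in> \<A>\<close>] insert.IH)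
  then show ?case
    by (intro measurable_null_augment_AE[OF subalgebra_past_field borel_measurable_P _ *]
        borel_measurable_diff borel_measurable_add) (simp_all add: sets.Int sets.Un)
qed

lemma P_past_finite_unions:
  assumes "D \<in> finite_unions \<A>" "D \<subseteq> B"
  shows "P D \<in> borel_measurable (past B)"
proof -
  obtain \<F> where "D = \<Union>\<F>" "finite \<F>" "\<F> \<subseteq> \<A>" using assms(1) by (auto simp: finite_unions_def)
  with P_past_Int_Union[OF _ _ indexing_UNIV, of \<F> B] assms(2) show ?thesis by simp
qed

text \<open>By the trace lemma it is enough to take \<open>A \<in> \<A>\<close>, and then
  \<open>A \<inter> B\<close> is a finite union of members of \<A> below \<open>B\<close>.\<close>

lemma P_past_Int:
  assumes B: "B \<in> finite_unions \<A>" and A: "A \<in> sets borel"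
  shows "P (A \<inter> B) \<in> borel_measurable (past B)"
proof (rule P_trace_measurable[OF subalgebra_past_field _ indexing_UNIV indexing_sets
      finite_unions_borel[OF B] _ A])
  show "Int_stable \<A>" by (rule Int_stableI) (rule indexing_Int)
  show "P (A \<inter> B) \<in> borel_measurable (past B)" if "A \<in> \<A>" for A
  proof -
    obtain \<F> where "B = \<Union>\<F>" "finite \<F>" "\<F> \<subseteq> \<A>" using B by (auto simp: finite_unions_def)
    with P_past_Int_Union[OF _ _ that, of \<F> B] show ?thesis by simp
  qed
qed

end

section \<open>The Markov property\<close>

text \<open>By the tower property, a conditional expectation given \<open>F\<close> that happens to
  be a function on \<open>K\<close> is the one given \<open>K\<close>. An explicit version
  \<open>g\<close> is thus exchanged for conditioning on \<open>K\<close>.\<close>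

lemma (in prob_space) real_cond_exp_eq_subalgebra:
  assumes F: "subalgebra M F" "subalgebra F K" and f: "integrable M f"
    and g: "g \<in> borel_measurable K" "AE x in M. real_cond_exp M F f x = g x"
  shows "AE x in M. real_cond_exp M F f x = real_cond_exp M K f x"
proof -
  have K: "subalgebra M K" using F by (auto simp: subalgebra_def)
  interpret F: sigma_finite_subalgebra M F by (rule sigma_finite_subalgebraI[OF F(1)])
  interpret K: sigma_finite_subalgebra M K by (rule sigma_finite_subalgebraI[OF K])
  have gM: "g \<in> borel_measurable M" by (rule measurable_from_subalg[OF K g(1)])
  have gi: "integrable M g"
    by (rule integrable_cong_AE_imp[OF F.real_cond_exp_int(1)[OF f] gM g(2)])
  have "AE x in M. real_cond_exp M K (real_cond_exp M F f) x = real_cond_exp M K f x"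
    by (rule K.real_cond_exp_nested_subalg[OF F f])
  moreover have "AE x in M. real_cond_exp M K (real_cond_exp M F f) x = real_cond_exp M K g x"
    by (rule K.real_cond_exp_cong[OF g(2) _ gM]) simp
  moreover have "AE x in M. real_cond_exp M K g x = g x"
    by (rule K.real_cond_exp_F_meas[OF gi g(1)])
  ultimately show ?thesis using g(2) by eventually_elim simp
qed

text \<open>Intersections of one event from each field form the generator that
  \<open>cond_indep_chain\<close> asks for.\<close>

lemma (in random_probability) sets_generated_field_Un:
  assumes "\<C> \<subseteq> sets borel" "\<D> \<subseteq> sets borel"
  shows "sets (generated_field M P (\<C> \<union> \<D>)) = sigma_sets (space M)
    {E1 \<inter> E2 | E1 E2. E1 \<in> sets (generated_field M P \<C>) \<and> E2 \<in> sets (generated_field M P \<D>)}"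
    (is "?L = sigma_sets _ ?I")
proof
  let ?U = "generated_field M P (\<C> \<union> \<D>)"
  have sub: "subalgebra ?U (generated_field M P \<C>)" "subalgebra ?U (generated_field M P \<D>)"
    using assms by (auto intro!: generated_field_mono)
  then have "?I \<subseteq> sets ?U" by (auto simp: subalgebra_def)
  from sets.sigma_sets_subset[OF this] show "sigma_sets (space M) ?I \<subseteq> ?L" by simp
  have top: "space M \<in> sets (generated_field M P \<E>)" for \<E>
    using sets.top[of "generated_field M P \<E>"] by simp
  have "E \<in> ?I" if "E \<in> {P A -` S \<inter> space M | A S. A \<in> \<C> \<union> \<D> \<and> S \<in> sets unit_borel}" for E
  proof -
    from that obtain A S where E: "E = P A -` S \<inter> space M" "A \<in> \<C> \<union> \<D>" "S \<in> sets unit_borel" by blast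
    from E(2) show ?thesis
    proof
      assume "A \<in> \<C>"
      from measurable_sets[OF measurable_generated_field[OF this assms(1)] E(3)]
      have "E \<in> sets (generated_field M P \<C>)" by (simp add: E(1))
      moreover have "E = E \<inter> space M" by (auto simp: E(1))
      ultimately show ?thesis using top by blast
    next
      assume "A \<in> \<D>"
      from measurable_sets[OF measurable_generated_field[OF this assms(2)] E(3)]
      have "E \<in> sets (generated_field M P \<D>)" by (simp add: E(1))
      moreover have "E = space M \<inter> E" by (auto simp: E(1))
      ultimately show ?thesis using top by blast
    qed
  qed
  then show "?L \<subseteq> sigma_sets (space M) ?I"
    unfolding sets_generated_field[of M P "\<C> \<union> \<D>"] by (intro sigma_sets_mono') blast
qed

locale markov_random_probability = indexed_random_probability M P \<A>
  for M :: "'w measure" and P :: "'x::t2_space set \<Rightarrow> 'w \<Rightarrow> real" and \<A> +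
  fixes Q :: "'x set \<Rightarrow> 'x set \<Rightarrow> real \<Rightarrow> real measure"
  assumes transition: "transition_system \<A> Q" and Q_Markov: "Q_Markov M \<A> Q P"
begin

abbreviation present :: "'x set \<Rightarrow> 'w measure" where
  "present B \<equiv> generated_field M P {B}"

lemma subalgebra_generated_past:
  assumes "\<C> \<subseteq> finite_unions \<A>" "\<And>A. A \<in> \<C> \<Longrightarrow> A \<subseteq> B"
  shows "subalgebra (past B) (generated_field M P \<C>)"
proof -
  have "sets (generated_field M P \<C>) \<subseteq> sets (past B)"
  proof (rule generated_field_subset_null_augment)
    show "\<C> \<subseteq> sets borel" using assms(1) finite_unions_borel by auto
    show "P A \<in> borel_measurable (past B)" if "A \<in> \<C>" for A
      using that assms by (intro P_past_finite_unions) auto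
  qed
  then show ?thesis by (simp add: subalgebra_def)
qed

text \<open>The Markov property with the kernel eliminated: its value at \<open>P B\<close> is
  measurable for the present, so conditioning on the past amounts to conditioning on the present.
  The past is the enlarged one, because \<open>P (A \<inter> B)\<close> has to belong to it
  later.\<close>

lemma cond_indep_present:
  assumes B: "B \<in> finite_unions \<A>" and C: "C \<in> finite_unions \<A>" and BC: "B \<subseteq> C"
  shows "cond_indep (present B) (past B) (present C)"
proof (rule cond_indepI[OF subalgebra_past subalgebra_generated_field _ sets_generated_field])
  let ?N = "{P A -` S \<inter> space M | A S. A \<in> {C} \<and> S \<in> sets unit_borel}"
  show "{C} \<subseteq> sets borel" using finite_unions_borel[OF C] by simp
  show sub: "subalgebra (past B) (present B)" by (rule subalgebra_generated_past) (use B in auto)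
  show "Int_stable ?N"
  proof (rule Int_stableI, clarify)
    fix S T :: "real set" assume "S \<in> sets unit_borel" "T \<in> sets unit_borel"
    then show "\<exists>A U. P C -` S \<inter> space M \<inter> (P C -` T \<inter> space M) = P A -` U \<inter> space M \<and> A \<in> {C} \<and> U \<in> sets unit_borel"
      by (intro exI[of _ C] exI[of _ "S \<inter> T"]) auto
  qed
  have "P C -` space unit_borel \<inter> space M = space M"
    using measurable_space[OF measurable_P[OF finite_unions_borel[OF C]]] by blast
  then show "space M \<in> ?N" using sets.top[of unit_borel] by blast
  fix E assume "E \<in> ?N"
  then obtain S where E: "E = {\<omega>\<in>space M. P C \<omega> \<in> S}" and S: "S \<in> sets unit_borel" by blast
  have EM: "E \<in> sets M"
    using measurable_sets[OF measurable_P[OF finite_unions_borel[OF C]] S] by (simp add: E vimage_def Int_def conj_commute)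
  let ?q = "\<lambda>\<omega>. measure (Q B C (P B \<omega>)) S"
  have "Q B C \<in> unit_borel \<rightarrow>\<^sub>M prob_algebra unit_borel"
    using transition B C BC by (simp add: transition_system_def)
  from measurable_compose[OF this measurable_measure_prob_algebra[OF S]]
  have "(\<lambda>z. measure (Q B C z) S) \<in> borel_measurable unit_borel" .
  from measurable_compose[OF measurable_generated_field this]
  have q: "?q \<in> borel_measurable (present B)" using finite_unions_borel[OF B] by simp
  have i: "integrable M (indicat_real E)" using EM by (simp add: less_top[symmetric])
  have "AE \<omega> in M. real_cond_exp M (past_field M \<A> P B) (indicator E) \<omega> = ?q \<omega>"
    using Q_Markov B C BC S by (simp add: Q_Markov_def cond_probability_def E)
  with real_cond_exp_null_augment[OF subalgebra_past_field[of B] i]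
  have "AE \<omega> in M. real_cond_exp M (past B) (indicator E) \<omega> = ?q \<omega>" by eventually_elim simp
  then show "AE \<omega> in M. real_cond_exp M (past B) (indicator E) \<omega> = real_cond_exp M (present B) (indicator E) \<omega>"
    by (rule real_cond_exp_eq_subalgebra[OF subalgebra_past sub i q])
qed

text \<open>For \<open>D = B \<union> (A0 \<inter> A)\<close>, the masses of the sets \<open>B \<union> (A0 \<inter> A')\<close> are obtained by
  modularity from those of \<open>B \<union> (A0 \<inter> A \<inter> A')\<close>, which lie below \<open>D\<close>, and those of
  \<open>D \<union> (A0 \<inter> A')\<close>, which lie above \<open>D\<close>. Hence the Markov property can be applied at \<open>D\<close>
  in between.\<close>

lemma cond_indep_finite_future:
  assumes "finite \<S>" "\<S> \<subseteq> \<A>" "A0 \<in> \<A>" "B \<in> finite_unions \<A>" "C \<in> finite_unions \<A>"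
    "B \<subseteq> C" "A0 \<inter> \<Union>\<S> \<subseteq> C"
  shows "cond_indep (present B) (past B) (generated_field M P (insert C {B \<union> (A0 \<inter> A) | A. A \<in> \<S>}))"
  using assms
proof (induction \<S> arbitrary: A0 B C rule: finite_induct)
  case empty
  then show ?case using cond_indep_present by simp
next
  case (insert A \<S>)
  define D where "D = B \<union> (A0 \<inter> A)"
  \<comment> \<open>\<open>D\<close> is included as the upper set so that the present of
    \<open>D\<close> lies in the field of \<open>\<C>1\<close>, as chaining requires; the statement
    carries an upper set \<open>C\<close> to make this possible.\<close>
  define \<C>1 where "\<C>1 = insert D {B \<union> ((A0 \<inter> A) \<inter> A') | A'. A' \<in> \<S>}"
  define \<C>2 where "\<C>2 = insert C {D \<union> (A0 \<inter> A') | A'. A' \<in> \<S>}"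
  have A: "A \<in> \<A>" "A0 \<inter> A \<in> \<A>" "\<S> \<subseteq> \<A>" using insert.prems by (auto intro: indexing_Int)
  have D: "D \<in> finite_unions \<A>" unfolding D_def
    by (rule finite_unions_Un[OF insert.prems(3) in_finite_unions[OF A(2)]])
  have U: "B \<union> A' \<in> finite_unions \<A>" "D \<union> A' \<in> finite_unions \<A>" if "A' \<in> \<A>" for A'
    using that D insert.prems(3) by (simp_all add: finite_unions_Un in_finite_unions)
  have \<C>: "\<C>1 \<subseteq> finite_unions \<A>" "\<C>2 \<subseteq> finite_unions \<A>"
    unfolding \<C>1_def \<C>2_def using D insert.prems A by (auto intro!: U indexing_Int)
  then have borel: "\<C>1 \<subseteq> sets borel" "\<C>2 \<subseteq> sets borel" "\<C>1 \<union> \<C>2 \<subseteq> sets borel" using finite_unions_borel by auto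
  \<comment> \<open>Below \<open>D\<close> the smaller set \<open>A0 \<inter> A\<close> takes the
    place of \<open>A0\<close>, while above \<open>D\<close> the base set changes and
    \<open>A0\<close> stays; hence \<open>A0\<close> and \<open>B\<close> are both arbitrary in the
    induction.\<close>
  have c1: "cond_indep (present B) (past B) (generated_field M P \<C>1)"
    unfolding \<C>1_def by (rule insert.IH) (use insert.prems A D in \<open>auto simp: D_def\<close>)
  have c2: "cond_indep (present D) (past D) (generated_field M P \<C>2)"
    unfolding \<C>2_def by (rule insert.IH) (use insert.prems A D in \<open>auto simp: D_def\<close>)
  have "cond_indep (present B) (past B) (generated_field M P (\<C>1 \<union> \<C>2))"
  proof (rule cond_indep_chain[OF c1 c2])
    show "subalgebra (past D) (past B)" by (rule subalgebra_past_mono) (simp add: D_def)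
    show "subalgebra (past D) (generated_field M P \<C>1)"
      by (rule subalgebra_generated_past[OF \<C>(1)]) (auto simp: \<C>1_def D_def)
    show "subalgebra (generated_field M P \<C>1) (present D)"
      by (rule generated_field_mono[OF _ borel(1)]) (simp add: \<C>1_def)
    show "subalgebra M (generated_field M P (\<C>1 \<union> \<C>2))" by (rule subalgebra_generated_field[OF borel(3)])
    show "sets (generated_field M P (\<C>1 \<union> \<C>2)) = sigma_sets (space M)
        {E1 \<inter> E2 | E1 E2. E1 \<in> sets (generated_field M P \<C>1) \<and> E2 \<in> sets (generated_field M P \<C>2)}"
      by (rule sets_generated_field_Un[OF borel(1,2)])
  qed
  then have c: "cond_indep (present B) (past B) (null_augment M (generated_field M P (\<C>1 \<union> \<C>2)))"
    (is "cond_indep _ _ ?G") by (rule cond_indep_null_augment)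
  show ?case
  proof (rule cond_indep_mono[OF c generated_field_subset_null_augment space_generated_field])
    let ?\<C> = "insert C {B \<union> (A0 \<inter> A') | A'. A' \<in> insert A \<S>}"
    show "?\<C> \<subseteq> sets borel"
      using insert.prems A by (auto intro!: finite_unions_borel U indexing_Int)
    have G: "P A' \<in> borel_measurable ?G" if "A' \<in> \<C>1 \<union> \<C>2" for A'
      using that borel(3) by (rule measurable_null_augment_generated_field)
    fix A' assume "A' \<in> ?\<C>"
    then consider "A' = C" | "A' = D" | A'' where "A'' \<in> \<S>" "A' = B \<union> (A0 \<inter> A'')"
      by (auto simp: D_def)
    then show "P A' \<in> borel_measurable ?G"
    proof cases
      case 1 then show ?thesis by (intro G) (simp add: \<C>2_def)
    next
      case 2 then show ?thesis by (intro G) (simp add: \<C>1_def)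
    next
      case 3
      have "A' \<in> finite_unions \<A>" unfolding 3 using insert.prems A 3(1)
        by (intro U indexing_Int) auto
      then have b: "D \<in> sets borel" "A' \<in> sets borel" using D by (auto intro: finite_unions_borel)
      have "AE \<omega> in M. P (D \<union> A') \<omega> + P (D \<inter> A') \<omega> = P D \<omega> + P A' \<omega>" by (rule P_modular[OF b])
      then have *: "AE \<omega> in M. P A' \<omega> = P (D \<union> A') \<omega> + P (D \<inter> A') \<omega> - P D \<omega>" by eventually_elim simp
      have eq: "D \<union> A' = D \<union> (A0 \<inter> A'')" "D \<inter> A' = B \<union> ((A0 \<inter> A) \<inter> A'')" by (auto simp: D_def 3)
      have "P (D \<union> A') \<in> borel_measurable ?G" "P (D \<inter> A') \<in> borel_measurable ?G" "P D \<in> borel_measurable ?G"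
        unfolding eq using 3(1) by (intro G; auto simp: \<C>1_def \<C>2_def)+
      then show ?thesis
        by (intro measurable_null_augment_AE[OF subalgebra_generated_field[OF borel(3)]
              borel_measurable_P[OF b(2)] _ *] borel_measurable_diff borel_measurable_add)
    qed
  qed
qed

section \<open>The future of a set and its independence of the past\<close>

abbreviation future :: "'x set \<Rightarrow> 'w measure" where
  "future B \<equiv> null_augment M (generated_field M P {B \<union> A | A. A \<in> \<A>})"

lemma future_generators_borel: "B \<in> finite_unions \<A> \<Longrightarrow> {B \<union> A | A. A \<in> \<A>} \<subseteq> sets borel"
  using indexing_borel finite_unions_borel by auto

text \<open>The field of all the masses is reduced to finite subfamilies: the union of their fields
  is intersection-stable, since two finite subfamilies lie in a common one, and it
  generates.\<close>

lemma cond_indep_future: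
  assumes B: "B \<in> finite_unions \<A>"
  shows "cond_indep (present B) (past B) (future B)"
proof (rule cond_indep_null_augment)
  define G where "G S = generated_field M P {B \<union> A | A. A \<in> S}" for S
  define N where "N = (\<Union>S\<in>{S. finite S \<and> S \<subseteq> \<A>}. sets (G S))"
  have borel: "{B \<union> A | A. A \<in> S} \<subseteq> sets borel" if "S \<subseteq> \<A>" for S
    using future_generators_borel[OF B] that by blast
  have mono: "sets (G S) \<subseteq> sets (G T)" if "S \<subseteq> T" "T \<subseteq> \<A>" for S T
  proof -
    have "{B \<union> A | A. A \<in> S} \<subseteq> {B \<union> A | A. A \<in> T}" using that by blast
    from generated_field_mono[OF this borel[OF that(2)]] show ?thesis by (simp add: G_def subalgebra_def)
  qed
  show "cond_indep (present B) (past B) (generated_field M P {B \<union> A | A. A \<in> \<A>})"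
  proof (rule cond_indepI[OF subalgebra_past subalgebra_generated_field[OF borel[OF order.refl]], where N = N])
    show "subalgebra (past B) (present B)" by (rule subalgebra_generated_past) (use B in auto)
    show "Int_stable N"
    proof (rule Int_stableI)
      fix a b assume "a \<in> N" "b \<in> N"
      then obtain S T where S: "finite S" "S \<subseteq> \<A>" "a \<in> sets (G S)" and T: "finite T" "T \<subseteq> \<A>" "b \<in> sets (G T)"
        unfolding N_def by blast
      then have "a \<in> sets (G (S \<union> T))" "b \<in> sets (G (S \<union> T))"
        using mono[of S "S \<union> T"] mono[of T "S \<union> T"] by auto
      then have "a \<inter> b \<in> sets (G (S \<union> T))" by (rule sets.Int)
      then show "a \<inter> b \<in> N" using S T unfolding N_def by (intro UN_I[of "S \<union> T"]) auto
    qed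
    have "space M \<in> sets (G {})" using sets.top[of "G {}"] by (simp add: G_def)
    then show "space M \<in> N" unfolding N_def by (intro UN_I[of "{}"]) auto
    show "sets (generated_field M P {B \<union> A | A. A \<in> \<A>}) = sigma_sets (space M) N"
    proof
      have "N \<subseteq> sets (G \<A>)" unfolding N_def by (intro UN_least mono) auto
      from sets.sigma_sets_subset[OF this]
      show "sigma_sets (space M) N \<subseteq> sets (generated_field M P {B \<union> A | A. A \<in> \<A>})" by (simp add: G_def)
      have "E \<in> N" if "E \<in> {P A' -` S \<inter> space M | A' S. A' \<in> {B \<union> A | A. A \<in> \<A>} \<and> S \<in> sets unit_borel}" for E
      proof -
        from that obtain A S where A: "A \<in> \<A>" "S \<in> sets unit_borel" and E: "E = P (B \<union> A) -` S \<inter> space M" by blast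
        have "E \<in> sets (G {A})"
          unfolding E G_def sets_generated_field by (rule sigma_sets.Basic) (use A in blast)
        then show ?thesis unfolding N_def using A by (intro UN_I[of "{A}"]) auto
      qed
      then show "sets (generated_field M P {B \<union> A | A. A \<in> \<A>}) \<subseteq> sigma_sets (space M) N"
        unfolding sets_generated_field by (intro sigma_sets_mono') blast
    qed
    fix E assume "E \<in> N"
    then obtain S where S: "finite S" "S \<subseteq> \<A>" "E \<in> sets (G S)" unfolding N_def by blast
    \<comment> \<open>\<open>UNIV\<close> serves both as \<open>A0\<close> and as the upper set, so
      the inclusions required in the finite case are trivial.\<close>
    let ?G' = "generated_field M P (insert UNIV {B \<union> (UNIV \<inter> A) | A. A \<in> S})"
    have ci: "cond_indep (present B) (past B) ?G'"
      by (rule cond_indep_finite_future) (use S B indexing_UNIV in_finite_unions in auto)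
    have "{B \<union> A | A. A \<in> S} \<subseteq> insert UNIV {B \<union> (UNIV \<inter> A) | A. A \<in> S}" by auto
    moreover have "insert UNIV {B \<union> (UNIV \<inter> A) | A. A \<in> S} \<subseteq> sets borel" using borel[OF S(2)] by auto
    ultimately have "subalgebra ?G' (G S)" unfolding G_def by (rule generated_field_mono)
    then have "E \<in> sets ?G'" using S(3) by (auto simp: subalgebra_def)
    moreover have "E \<in> sets M" using S(3) subalgebra_generated_field[OF borel[OF S(2)]]
      unfolding G_def subalgebra_def by blast
    ultimately show "AE \<omega> in M. real_cond_exp M (past B) (indicator E) \<omega> = real_cond_exp M (present B) (indicator E) \<omega>"
      by (intro cond_indep_cond_exp[OF ci]) (auto simp: less_top[symmetric])
  qed
qed

text \<open>For \<open>A \<in> \<A>\<close> the mass is \<open>P (B \<union> A) - P B\<close>, a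
  difference of two generators of the future, where \<open>P B\<close> is the generator for
  \<open>A = {}\<close>. The trace lemma on the complement of \<open>B\<close> extends this to Borel
  sets.\<close>

lemma P_future_Diff:
  assumes B: "B \<in> finite_unions \<A>" and A: "A \<in> sets borel"
  shows "P (A - B) \<in> borel_measurable (future B)"
proof -
  note Bb = finite_unions_borel[OF B] and Fb = future_generators_borel[OF B]
  have "P (A \<inter> - B) \<in> borel_measurable (future B)"
  proof (rule P_trace_measurable[OF subalgebra_generated_field[OF Fb] _ indexing_UNIV indexing_sets _ _ A])
    show "Int_stable \<A>" by (rule Int_stableI) (rule indexing_Int)
    show "- B \<in> sets borel" using Bb by (rule borel_comp)
    fix A assume A: "A \<in> \<A>"
    then have Ab: "A \<in> sets borel" using indexing_borel by auto
    have "AE \<omega> in M. P (B \<union> (A \<inter> - B)) \<omega> = P B \<omega> + P (A \<inter> - B) \<omega>"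
      by (rule P_Un) (use Ab Bb in auto)
    moreover have "B \<union> (A \<inter> - B) = B \<union> A" "B \<union> {} = B" by auto
    ultimately have *: "AE \<omega> in M. P (A \<inter> - B) \<omega> = P (B \<union> A) \<omega> - P (B \<union> {}) \<omega>" by auto
    have "P (B \<union> A') \<in> borel_measurable (future B)" if "A' \<in> \<A>" for A'
      by (rule measurable_null_augment_generated_field[OF _ Fb]) (use that in auto)
    note m = borel_measurable_diff[OF this[OF A] this[OF indexing_empty]]
    show "P (A \<inter> - B) \<in> borel_measurable (future B)"
      by (rule measurable_null_augment_AE[OF subalgebra_generated_field[OF Fb] borel_measurable_P m *])
        (use Ab Bb in auto)
  qed
  then show ?thesis by (simp add: Diff_eq)
qed

lemma P_future_self:
  assumes B: "B \<in> finite_unions \<A>"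
  shows "P B \<in> borel_measurable (future B)"
proof -
  have "P (B \<union> {}) \<in> borel_measurable (future B)"
    by (rule measurable_null_augment_generated_field[OF _ future_generators_borel[OF B]])
      (use indexing_empty in auto)
  then show ?thesis by simp
qed

text \<open>A finite union \<open>C\<close> is in general not \<open>B \<union> A\<close> with a
  single \<open>A \<in> \<A>\<close>, so its mass is recovered from \<open>P B\<close> and
  \<open>P (C - B)\<close>.\<close>

lemma P_future_above:
  assumes B: "B \<in> finite_unions \<A>" and C: "C \<in> finite_unions \<A>" and BC: "B \<subseteq> C"
  shows "P C \<in> borel_measurable (future B)"
proof -
  note b = finite_unions_borel[OF B] finite_unions_borel[OF C]
  have "AE \<omega> in M. P (B \<union> (C - B)) \<omega> = P B \<omega> + P (C - B) \<omega>"
    by (rule P_Un) (use b in auto)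
  moreover have "B \<union> (C - B) = C" using BC by auto
  ultimately have *: "AE \<omega> in M. P C \<omega> = P B \<omega> + P (C - B) \<omega>" by simp
  show ?thesis
    by (rule measurable_null_augment_AE[OF subalgebra_generated_field[OF future_generators_borel[OF B]]
          borel_measurable_P[OF b(2)] borel_measurable_add[OF P_future_self[OF B] P_future_Diff[OF B b(2)]] *])
qed

end

section \<open>Samples\<close>

lemma sets_vimage_algebra_subset:
  assumes "f \<in> F \<rightarrow>\<^sub>M N"
  shows "sets (vimage_algebra (space F) f N) \<subseteq> sets F"
proof -
  have "f \<in> space F \<rightarrow> space N" using measurable_space[OF assms] by blast
  from sets_vimage_algebra2[OF this] show ?thesis using measurable_sets[OF assms] by auto
qed

locale markov_sample = markov_random_probability M P \<A> Q
  for M :: "'w measure" and P :: "'x::t2_space set \<Rightarrow> 'w \<Rightarrow> real" and \<A> Q +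
  fixes n :: nat and X :: "nat \<Rightarrow> 'w \<Rightarrow> 'x"
  assumes sample: "sample_from M P n X"
begin

definition hits :: "nat set \<Rightarrow> (nat \<Rightarrow> 'x set) \<Rightarrow> 'w set" where
  "hits J A = {\<omega>\<in>space M. \<forall>i\<in>J. X i \<omega> \<in> A i}"

lemma measurable_X: "i \<in> {1..n} \<Longrightarrow> X i \<in> M \<rightarrow>\<^sub>M borel"
  using sample unfolding sample_from_def by blast

lemma hits_sets:
  assumes F: "space F = space M" "\<And>i. i \<in> J \<Longrightarrow> X i \<in> F \<rightarrow>\<^sub>M borel" and J: "J \<subseteq> {1..n}" and A: "\<And>i. A i \<in> sets borel"
  shows "hits J A \<in> sets F"
proof -
  have "{\<omega>\<in>space F. \<forall>i\<in>J. X i \<omega> \<in> A i} \<in> sets F"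
  proof (rule sets.sets_Collect_finite_All)
    show "finite J" using J finite_subset by blast
    fix i assume "i \<in> J"
    from measurable_sets[OF F(2)[OF this] A[of i]]
    show "{\<omega>\<in>space F. X i \<omega> \<in> A i} \<in> sets F" by (simp add: vimage_def Int_def conj_commute)
  qed
  then show ?thesis by (simp add: hits_def F(1))
qed

lemma hits_events: "J \<subseteq> {1..n} \<Longrightarrow> (\<And>i. A i \<in> sets borel) \<Longrightarrow> hits J A \<in> sets M"
  by (rule hits_sets[OF refl measurable_X]) auto

abbreviation masses :: "'w measure" where
  "masses \<equiv> null_augment M (generated_field M P (sets borel))"

lemma subalgebra_masses: "subalgebra M masses"
  by (intro subalgebra_null_augment subalgebra_generated_field) simp

lemma masses_subalgebra: "\<C> \<subseteq> sets borel \<Longrightarrow> subalgebra masses (null_augment M (generated_field M P \<C>))"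
  using null_augment_mono[OF subalgebra_generated_field generated_field_mono, of "sets borel" \<C>]
  by (simp add: subalgebra_def)

lemma prod_P_unit_interval:
  assumes "\<And>i. A i \<in> sets borel" "\<omega> \<in> space M"
  shows "(\<Prod>i\<in>J. P (A i) \<omega>) \<in> {0..1}"
  using P_unit_interval[OF assms] by (auto intro: prod_nonneg prod_le_1)

text \<open>The sample property tested against a function of the masses: the event that the
  observations hit given sets may be traded for the product of their masses. Later it is used in
  both directions.\<close>

lemma sample_integral:
  assumes A: "\<And>i. A i \<in> sets borel" and w: "integrable M w" "w \<in> borel_measurable masses"
  shows "(\<integral>\<omega>. w \<omega> * indicator (hits {1..n} A) \<omega> \<partial>M) = (\<integral>\<omega>. w \<omega> * (\<Prod>i\<in>{1..n}. P (A i) \<omega>) \<partial>M)"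
proof -
  interpret G: sigma_finite_subalgebra M masses by (rule sigma_finite_subalgebraI[OF subalgebra_masses])
  have h: "hits {1..n} A \<in> sets M" by (rule hits_events) (simp_all add: A)
  have i: "integrable M (indicat_real (hits {1..n} A))" using h by (simp add: less_top[symmetric])
  have "AE \<omega> in M. real_cond_exp M (generated_field M P (sets borel)) (indicator (hits {1..n} A)) \<omega> = (\<Prod>i\<in>{1..n}. P (A i) \<omega>)"
    using sample A unfolding sample_from_def cond_probability_def hits_def by blast
  with real_cond_exp_null_augment[OF subalgebra_generated_field[OF order.refl] i]
  have ae: "AE \<omega> in M. real_cond_exp M masses (indicator (hits {1..n} A)) \<omega> = (\<Prod>i\<in>{1..n}. P (A i) \<omega>)"
    by eventually_elim simp
  have "integrable M (\<lambda>\<omega>. w \<omega> * indicator (hits {1..n} A) \<omega>)"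
    using integrable_mult_unit_interval[OF w(1), of "indicator (hits {1..n} A)"] h
    by (simp add: mult.commute indicator_def)
  then have "(\<integral>\<omega>. w \<omega> * indicator (hits {1..n} A) \<omega> \<partial>M) = (\<integral>\<omega>. w \<omega> * real_cond_exp M masses (indicator (hits {1..n} A)) \<omega> \<partial>M)"
    using h w(2) by (intro G.real_cond_exp_intg(2)[symmetric]) auto
  also have "\<dots> = (\<integral>\<omega>. w \<omega> * (\<Prod>i\<in>{1..n}. P (A i) \<omega>) \<partial>M)"
    using ae w(1) A by (intro integral_cong_AE) (auto intro!: borel_measurable_times borel_measurable_prod borel_measurable_P)
  finally show ?thesis .
qed

text \<open>Given \<open>P\<close>, the observations inside \<open>B\<close> enter through masses known in the past of \<open>B\<close>, those
  outside \<open>B\<close> through masses known in its future. Averaging the former over the present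
  leaves a factor that depends on \<open>P B\<close> only.\<close>

definition inner_weight :: "'x set \<Rightarrow> nat set \<Rightarrow> (nat \<Rightarrow> 'x set) \<Rightarrow> ('w \<Rightarrow> real) \<Rightarrow> 'w \<Rightarrow> real" where
  "inner_weight B J A u = real_cond_exp M (present B) (\<lambda>\<omega>. u \<omega> * (\<Prod>i\<in>{1..n} - J. P (A i \<inter> B) \<omega>))"

lemma inner_weight:
  assumes B: "B \<in> finite_unions \<A>" and A: "\<And>i. A i \<in> sets borel"
    and u: "u \<in> borel_measurable (past B)" "\<And>\<omega>. \<omega> \<in> space M \<Longrightarrow> u \<omega> \<in> {0..1}"
  shows "(\<lambda>\<omega>. u \<omega> * (\<Prod>i\<in>{1..n} - J. P (A i \<inter> B) \<omega>)) \<in> borel_measurable (past B)"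
    and "\<And>\<omega>. \<omega> \<in> space M \<Longrightarrow> u \<omega> * (\<Prod>i\<in>{1..n} - J. P (A i \<inter> B) \<omega>) \<in> {0..1}"
    and "integrable M (inner_weight B J A u)"
    and "inner_weight B J A u \<in> borel_measurable (present B)"
proof -
  note Bb = finite_unions_borel[OF B]
  have AB: "A i \<inter> B \<in> sets borel" for i using A Bb by (rule sets.Int)
  show m: "(\<lambda>\<omega>. u \<omega> * (\<Prod>i\<in>{1..n} - J. P (A i \<inter> B) \<omega>)) \<in> borel_measurable (past B)"
    by (intro borel_measurable_times borel_measurable_prod u P_past_Int[OF B] A)
  show b: "u \<omega> * (\<Prod>i\<in>{1..n} - J. P (A i \<inter> B) \<omega>) \<in> {0..1}" if "\<omega> \<in> space M" for \<omega>
    using u(2)[OF that] prod_P_unit_interval[OF AB that, where J = "{1..n} - J"] by (auto intro: mult_le_one)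
  have K: "subalgebra M (present B)" using Bb by (intro subalgebra_generated_field) simp
  interpret K: sigma_finite_subalgebra M "present B" by (rule sigma_finite_subalgebraI[OF K])
  show "integrable M (inner_weight B J A u)" unfolding inner_weight_def
    by (intro K.real_cond_exp_int real_cond_exp_unit_interval(1)[OF K] b measurable_from_subalg[OF subalgebra_past m])
  show "inner_weight B J A u \<in> borel_measurable (present B)" unfolding inner_weight_def by simp
qed

text \<open>Trade the observations for masses; the product splits into a past factor (indices not in
  \<open>J\<close>) and a future factor (indices in \<open>J\<close>). Conditional independence
  averages the past factor over the present, leaving \<open>inner_weight\<close>. Trading the future
  masses back for observations leaves no constraint on the inner ones.\<close>

lemma sample_split_integral:
  assumes B: "B \<in> finite_unions \<A>" and A: "\<And>i. A i \<in> sets borel" and J: "J \<subseteq> {1..n}"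
    and u: "u \<in> borel_measurable (past B)" "\<And>\<omega>. \<omega> \<in> space M \<Longrightarrow> u \<omega> \<in> {0..1}"
    and v: "v \<in> borel_measurable (future B)" "\<And>\<omega>. \<omega> \<in> space M \<Longrightarrow> v \<omega> \<in> {0..1}"
  shows "(\<integral>\<omega>. u \<omega> * v \<omega> * indicator (hits {1..n} (\<lambda>i. if i \<in> J then A i - B else A i \<inter> B)) \<omega> \<partial>M) =
     (\<integral>\<omega>. inner_weight B J A u \<omega> * v \<omega> * indicator (hits J (\<lambda>i. A i - B)) \<omega> \<partial>M)"
proof -
  note Bb = finite_unions_borel[OF B]
  note iw = inner_weight[OF B A u, where J = J]
  let ?T = "\<lambda>i. if i \<in> J then A i - B else A i \<inter> B"
  let ?S = "\<lambda>i. if i \<in> J then A i - B else UNIV"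
  let ?U = "\<lambda>\<omega>. \<Prod>i\<in>{1..n} - J. P (A i \<inter> B) \<omega>"
  let ?V = "\<lambda>\<omega>. \<Prod>i\<in>J. P (A i - B) \<omega>"
  let ?a = "inner_weight B J A u"
  have b: "A i - B \<in> sets borel" "A i \<inter> B \<in> sets borel" "?T i \<in> sets borel" "?S i \<in> sets borel" for i
    using A Bb by auto
  have pastG: "subalgebra masses (past B)" unfolding past_field_def
    using indexing_borel by (intro masses_subalgebra) auto
  have futG: "subalgebra masses (future B)" by (intro masses_subalgebra future_generators_borel B)
  have presG: "subalgebra masses (present B)"
    using subalgebra_generated_past[of "{B}" B] B pastG by (auto simp: subalgebra_def)
  have uM: "u \<in> borel_measurable M" and vM: "v \<in> borel_measurable M"
    using measurable_from_subalg[OF pastG u(1)] measurable_from_subalg[OF futG v(1)]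
    by (auto intro: measurable_from_subalg[OF subalgebra_masses])
  have iv: "integrable M v" by (rule integrable_const_bound[where B = 1]) (use v(2) vM in auto)
  have iuv: "integrable M (\<lambda>\<omega>. u \<omega> * v \<omega>)" by (rule integrable_mult_unit_interval[OF iv uM]) (use u(2) in auto)
  have VM: "?V \<in> borel_measurable M" by (intro borel_measurable_prod borel_measurable_P b)
  have V01: "AE \<omega> in M. ?V \<omega> \<in> {0..1}" by (rule AE_I2) (rule prod_P_unit_interval[OF b(1)])
  have ivV: "integrable M (\<lambda>\<omega>. v \<omega> * ?V \<omega>)"
    using integrable_mult_unit_interval[OF iv VM V01] by (simp add: mult.commute)
  have vV: "(\<lambda>\<omega>. v \<omega> * ?V \<omega>) \<in> borel_measurable (future B)"
    by (intro borel_measurable_times borel_measurable_prod v P_future_Diff[OF B] A)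
  have iav: "integrable M (\<lambda>\<omega>. ?a \<omega> * v \<omega>)"
    using integrable_mult_unit_interval[OF iw(3) vM] v(2) by (simp add: mult.commute)
  have split: "(\<Prod>i\<in>{1..n}. f i) = (\<Prod>i\<in>{1..n} - J. f i) * (\<Prod>i\<in>J. f i)" for f :: "nat \<Rightarrow> real"
    by (rule prod.subset_diff[OF J]) simp
  have "(\<integral>\<omega>. u \<omega> * v \<omega> * indicator (hits {1..n} ?T) \<omega> \<partial>M) = (\<integral>\<omega>. u \<omega> * v \<omega> * (\<Prod>i\<in>{1..n}. P (?T i) \<omega>) \<partial>M)"
    by (intro sample_integral b(3) iuv borel_measurable_times measurable_from_subalg[OF pastG u(1)]
        measurable_from_subalg[OF futG v(1)])
  also have "\<dots> = (\<integral>\<omega>. (u \<omega> * ?U \<omega>) * (v \<omega> * ?V \<omega>) \<partial>M)"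
    unfolding split by (simp add: mult_ac)
  also have "\<dots> = (\<integral>\<omega>. ?a \<omega> * (v \<omega> * ?V \<omega>) \<partial>M)"
    unfolding inner_weight_def by (rule cond_indep_integral[OF cond_indep_future[OF B] ivV vV iw(1,2)])
  \<comment> \<open>Every index needs a set before masses can be traded back; those not in
    \<open>J\<close> receive \<open>UNIV\<close>, of mass 1 almost surely.\<close>
  also have "\<dots> = (\<integral>\<omega>. ?a \<omega> * v \<omega> * (\<Prod>i\<in>{1..n}. P (?S i) \<omega>) \<partial>M)"
  proof (rule integral_cong_AE)
    have aM: "?a \<in> borel_measurable M" using iw(3) by simp
    show "(\<lambda>\<omega>. ?a \<omega> * (v \<omega> * ?V \<omega>)) \<in> borel_measurable M" by (intro borel_measurable_times aM vM VM)
    show "(\<lambda>\<omega>. ?a \<omega> * v \<omega> * (\<Prod>i\<in>{1..n}. P (?S i) \<omega>)) \<in> borel_measurable M"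
      by (intro borel_measurable_times aM vM borel_measurable_prod borel_measurable_P b)
    show "AE \<omega> in M. ?a \<omega> * (v \<omega> * ?V \<omega>) = ?a \<omega> * v \<omega> * (\<Prod>i\<in>{1..n}. P (?S i) \<omega>)"
      using P_UNIV unfolding split by eventually_elim simp
  qed
  also have "\<dots> = (\<integral>\<omega>. ?a \<omega> * v \<omega> * indicator (hits {1..n} ?S) \<omega> \<partial>M)"
    by (intro sample_integral[symmetric] b(4) iav borel_measurable_times measurable_from_subalg[OF presG iw(4)]
        measurable_from_subalg[OF futG v(1)])
  also have "hits {1..n} ?S = hits J (\<lambda>i. A i - B)" using J by (auto simp: hits_def)
  finally show ?thesis .
qed

text \<open>The sigma-field of \<open>P B\<close> and the observations with index in
  \<open>J\<close>, written through rectangles because these are intersection-stable and the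
  integral identities are available on them.\<close>

definition outer_field :: "'x set \<Rightarrow> nat set \<Rightarrow> 'w measure" where
  "outer_field B J = sigma (space M)
     {k \<inter> hits J A | k A. k \<in> sets (present B) \<and> (\<forall>i. A i \<in> sets borel)}"

lemma space_outer_field [simp]: "space (outer_field B J) = space M"
  by (simp add: outer_field_def space_measure_of_conv)

lemma outer_field:
  assumes B: "B \<in> finite_unions \<A>" and J: "J \<subseteq> {1..n}"
  defines "N \<equiv> {k \<inter> hits J A | k A. k \<in> sets (present B) \<and> (\<forall>i. A i \<in> sets borel)}"
  shows "sets (outer_field B J) = sigma_sets (space M) N" "Int_stable N" "space M \<in> N"
    "subalgebra M (outer_field B J)"
proof -
  have K: "subalgebra M (present B)" using finite_unions_borel[OF B] by (intro subalgebra_generated_field) simp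
  have N: "N \<subseteq> sets M"
    unfolding N_def using K hits_events[OF J] by (auto simp: subalgebra_def)
  then have "N \<subseteq> Pow (space M)" using sets.space_closed by blast
  then show eq: "sets (outer_field B J) = sigma_sets (space M) N"
    unfolding outer_field_def N_def by (rule sets_measure_of)
  show "Int_stable N"
  proof (rule Int_stableI)
    fix a b assume "a \<in> N" "b \<in> N"
    then obtain k A l A' where a: "a = k \<inter> hits J A" "k \<in> sets (present B)" "\<And>i. A i \<in> sets borel"
      and b: "b = l \<inter> hits J A'" "l \<in> sets (present B)" "\<And>i. A' i \<in> sets borel"
      unfolding N_def by blast
    have "a \<inter> b = (k \<inter> l) \<inter> hits J (\<lambda>i. A i \<inter> A' i)" unfolding a(1) b(1) hits_def by blast
    moreover have "k \<inter> l \<in> sets (present B)" using a(2) b(2) by (rule sets.Int)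
    moreover have "\<forall>i. A i \<inter> A' i \<in> sets borel" using a(3) b(3) by (auto intro: sets.Int)
    ultimately show "a \<inter> b \<in> N" unfolding N_def by blast
  qed
  have "space M = space M \<inter> hits J (\<lambda>_. UNIV)" by (simp add: hits_def)
  moreover have "space M \<in> sets (present B)" using sets.top[of "present B"] by simp
  ultimately show "space M \<in> N" unfolding N_def by force
  show "subalgebra M (outer_field B J)"
    unfolding subalgebra_def eq using sets.sigma_sets_subset[OF N] by simp
qed

text \<open>Given \<open>P B\<close> and the outer observations, \<open>u\<close> and the inner
  observations matter only through \<open>inner_weight\<close>. On a test rectangle
  \<open>k \<inter> hits J C\<close> this is \<open>sample_split_integral\<close> with the indicator
  of \<open>k\<close> as future factor.\<close>

lemma sample_cond_exp_outer:
  assumes B: "B \<in> finite_unions \<A>" and A: "\<And>i. A i \<in> sets borel" and J: "J \<subseteq> {1..n}"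
    and u: "u \<in> borel_measurable (past B)" "\<And>\<omega>. \<omega> \<in> space M \<Longrightarrow> u \<omega> \<in> {0..1}"
  defines "f \<equiv> \<lambda>\<omega>. u \<omega> * indicat_real (hits {1..n} (\<lambda>i. if i \<in> J then - B else A i \<inter> B)) \<omega>"
    and "g \<equiv> \<lambda>\<omega>. inner_weight B J A u \<omega> * indicat_real (hits J (\<lambda>_. - B)) \<omega>"
  shows "AE \<omega> in M. real_cond_exp M (outer_field B J) f \<omega> = real_cond_exp M (outer_field B J) g \<omega>"
    and "integrable M f" and "integrable M g" and "\<And>\<omega>. \<omega> \<in> space M \<Longrightarrow> f \<omega> \<in> {0..1}"
proof -
  note Bb = finite_unions_borel[OF B] and of = outer_field[OF B J]
  interpret H: sigma_finite_subalgebra M "outer_field B J" by (rule sigma_finite_subalgebraI[OF of(4)])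
  have ev: "hits {1..n} (\<lambda>i. if i \<in> J then - B else A i \<inter> B) \<in> sets M" "hits J (\<lambda>_. - B) \<in> sets M"
    using A Bb J by (auto intro!: hits_events)
  have uM: "u \<in> borel_measurable M" by (rule measurable_from_subalg[OF subalgebra_past u(1)])
  show f01: "f \<omega> \<in> {0..1}" if "\<omega> \<in> space M" for \<omega>
    using u(2)[OF that] by (simp add: f_def indicator_def)
  show fi: "integrable M f"
    by (rule integrable_const_bound[where B = 1]) (use f01 uM ev in \<open>auto simp: f_def\<close>)
  show gi: "integrable M g"
    using integrable_mult_unit_interval[OF inner_weight(3)[where A = A and J = J, OF B A u], of "indicator (hits J (\<lambda>_. - B))"] ev
    by (simp add: g_def mult.commute indicator_def)
  show "AE \<omega> in M. real_cond_exp M (outer_field B J) f \<omega> = real_cond_exp M (outer_field B J) g \<omega>"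
  proof (rule real_cond_exp_charact_generator[OF of(4,1,2,3) fi])
    show "integrable M (real_cond_exp M (outer_field B J) g)" by (rule H.real_cond_exp_int(1)[OF gi])
    show "real_cond_exp M (outer_field B J) g \<in> borel_measurable (null_augment M (outer_field B J))"
      by (rule measurable_from_subalg[OF null_augment_subalgebra[OF of(4)]]) simp
    fix E assume E: "E \<in> {k \<inter> hits J A | k A. k \<in> sets (present B) \<and> (\<forall>i. A i \<in> sets borel)}"
    then have EH: "E \<in> sets (outer_field B J)" unfolding of(1) by (rule sigma_sets.Basic)
    from E obtain k C where E: "E = k \<inter> hits J C" and k: "k \<in> sets (present B)" and C: "\<And>i. C i \<in> sets borel" by blast
    \<comment> \<open>The test rectangle supplies the sets on \<open>J\<close>;
      \<open>inner_weight\<close> reads only the sets with index outside \<open>J\<close>, so it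
      does not change.\<close>
    let ?A = "\<lambda>i. if i \<in> J then C i else A i"
    have A': "?A i \<in> sets borel" for i using A C by simp
    \<comment> \<open>\<open>P B\<close> belongs to the past and to the future, so an event of the
      present is an admissible future factor.\<close>
    have kf: "k \<in> sets (future B)"
    proof -
      have "sets (present B) \<subseteq> sets (future B)"
        by (rule generated_field_subset_null_augment) (use Bb P_future_self[OF B] in auto)
      then show ?thesis using k by blast
    qed
    then have kv: "indicat_real k \<in> borel_measurable (future B)" by simp
    have iw: "inner_weight B J ?A u = inner_weight B J A u"
      unfolding inner_weight_def 
      by (intro arg_cong[where f = "real_cond_exp M (present B)"] ext arg_cong2[where f = "(*)"] refl prod.cong) auto
    have "(\<integral>\<omega>\<in>E. f \<omega> \<partial>M) = (\<integral>\<omega>. u \<omega> * indicator k \<omega> * indicator (hits {1..n} (\<lambda>i. if i \<in> J then ?A i - B else ?A i \<inter> B)) \<omega> \<partial>M)"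
      unfolding set_lebesgue_integral_def f_def E
    proof (intro Bochner_Integration.integral_cong refl)
      fix \<omega>
      have "\<omega> \<in> k \<inter> hits J C \<and> \<omega> \<in> hits {1..n} (\<lambda>i. if i \<in> J then - B else A i \<inter> B) \<longleftrightarrow>
          \<omega> \<in> k \<and> \<omega> \<in> hits {1..n} (\<lambda>i. if i \<in> J then ?A i - B else ?A i \<inter> B)"
        using J unfolding hits_def by (auto split: if_splits)
      then show "indicat_real (k \<inter> hits J C) \<omega> *\<^sub>R (u \<omega> * indicat_real (hits {1..n} (\<lambda>i. if i \<in> J then - B else A i \<inter> B)) \<omega>) =
          u \<omega> * indicator k \<omega> * indicator (hits {1..n} (\<lambda>i. if i \<in> J then ?A i - B else ?A i \<inter> B)) \<omega>"
        by (auto simp: indicator_def)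
    qed
    also have "\<dots> = (\<integral>\<omega>. inner_weight B J ?A u \<omega> * indicator k \<omega> * indicator (hits J (\<lambda>i. ?A i - B)) \<omega> \<partial>M)"
      by (rule sample_split_integral[OF B A' J u kv]) (auto simp: indicator_def)
    also have "\<dots> = (\<integral>\<omega>\<in>E. g \<omega> \<partial>M)"
      unfolding set_lebesgue_integral_def g_def E iw
    proof (intro Bochner_Integration.integral_cong refl)
      fix \<omega>
      have "\<omega> \<in> hits J (\<lambda>i. ?A i - B) \<longleftrightarrow> \<omega> \<in> hits J C \<and> \<omega> \<in> hits J (\<lambda>_. - B)"
        unfolding hits_def by auto
      then show "inner_weight B J A u \<omega> * indicator k \<omega> * indicator (hits J (\<lambda>i. ?A i - B)) \<omega> =
          indicat_real (k \<inter> hits J C) \<omega> *\<^sub>R (inner_weight B J A u \<omega> * indicat_real (hits J (\<lambda>_. - B)) \<omega>)"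
        by (auto simp: indicator_def)
    qed
    also have "\<dots> = (\<integral>\<omega>\<in>E. real_cond_exp M (outer_field B J) g \<omega> \<partial>M)"
      by (rule H.real_cond_exp_intA[OF gi EH])
    finally show "(\<integral>\<omega>\<in>E. f \<omega> \<partial>M) = (\<integral>\<omega>\<in>E. real_cond_exp M (outer_field B J) g \<omega> \<partial>M)" .
  qed
qed

text \<open>\<open>sample_split_integral\<close> turns \<open>u\<close> and the inner observations
  into a weight measurable for \<open>outer_field\<close>, so \<open>v\<close> can be projected. The
  projection involves observations, not masses alone, so the same identity cannot undo the first
  step. The return goes through \<open>sample_cond_exp_outer\<close>: \<open>f\<close> and
  \<open>g\<close> have the same projection.\<close>

lemma sample_pattern_integral:
  assumes B: "B \<in> finite_unions \<A>" and A: "\<And>i. A i \<in> sets borel" and J: "J \<subseteq> {1..n}"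
    and u: "u \<in> borel_measurable (past B)" "\<And>\<omega>. \<omega> \<in> space M \<Longrightarrow> u \<omega> \<in> {0..1}"
    and v: "v \<in> borel_measurable (future B)" "\<And>\<omega>. \<omega> \<in> space M \<Longrightarrow> v \<omega> \<in> {0..1}"
  defines "T \<equiv> hits {1..n} (\<lambda>i. if i \<in> J then A i - B else A i \<inter> B)"
  shows "(\<integral>\<omega>. u \<omega> * indicator T \<omega> * v \<omega> \<partial>M) =
     (\<integral>\<omega>. u \<omega> * indicator T \<omega> * real_cond_exp M (outer_field B J) v \<omega> \<partial>M)"
proof -
  note Bb = finite_unions_borel[OF B] and of = outer_field[OF B J] and iw = inner_weight[where A = A and J = J, OF B A u]
  let ?H = "outer_field B J" and ?a = "inner_weight B J A u"
  interpret H: sigma_finite_subalgebra M ?H by (rule sigma_finite_subalgebraI[OF of(4)])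
  define f where "f = (\<lambda>\<omega>. u \<omega> * indicat_real (hits {1..n} (\<lambda>i. if i \<in> J then - B else A i \<inter> B)) \<omega>)"
  define g where "g = (\<lambda>\<omega>. ?a \<omega> * indicat_real (hits J (\<lambda>_. - B)) \<omega>)"
  note fg = sample_cond_exp_outer[where A = A, OF B A J u, folded f_def g_def]
  have vM: "v \<in> borel_measurable M"
    by (rule measurable_from_subalg[OF subalgebra_null_augment[OF subalgebra_generated_field[OF future_generators_borel[OF B]]] v(1)])
  have iv: "integrable M v" by (rule integrable_const_bound[where B = 1]) (use v(2) vM in auto)
  define c where "c = real_cond_exp M ?H v"
  have cm: "c \<in> borel_measurable ?H" and ci: "integrable M c"
    unfolding c_def using H.real_cond_exp_int(1)[OF iv] by auto
  have hit_H: "indicat_real (hits J A') \<in> borel_measurable ?H" if "\<And>i. A' i \<in> sets borel" for A'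
  proof -
    have "space M \<in> sets (present B)" using sets.top[of "present B"] by simp
    moreover have "hits J A' = space M \<inter> hits J A'" by (auto simp: hits_def)
    ultimately have "hits J A' \<in> {k \<inter> hits J A | k A. k \<in> sets (present B) \<and> (\<forall>i. A i \<in> sets borel)}"
      using that by blast
    then have "hits J A' \<in> sets ?H" unfolding of(1) by (rule sigma_sets.Basic)
    then show ?thesis by simp
  qed
  have a_H: "?a \<in> borel_measurable ?H"
  proof -
    have "sets (present B) \<subseteq> sets ?H"
    proof
      fix k assume k: "k \<in> sets (present B)"
      have "k = k \<inter> hits J (\<lambda>_. UNIV)" using sets.sets_into_space[OF k] by (auto simp: hits_def)
      then have "k \<in> {k \<inter> hits J A | k A. k \<in> sets (present B) \<and> (\<forall>i. A i \<in> sets borel)}" using k by force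
      then show "k \<in> sets ?H" unfolding of(1) by (rule sigma_sets.Basic)
    qed
    then have "subalgebra ?H (present B)" by (simp add: subalgebra_def)
    from measurable_from_subalg[OF this iw(4)] show ?thesis .
  qed
  let ?h = "\<lambda>\<omega>. indicat_real (hits J A) \<omega>" and ?o = "indicat_real (hits J (\<lambda>i. A i - B))"
  have hm: "?h \<in> borel_measurable ?H" "?o \<in> borel_measurable ?H"
    using A Bb by (auto intro!: hit_H)
  have hM: "?h \<in> borel_measurable M" "?o \<in> borel_measurable M"
    using hm by (auto intro: measurable_from_subalg[OF of(4)])
  \<comment> \<open>The constraint \<open>A i - B\<close> on an outer observation is divided:
    \<open>A i\<close> goes to a factor measurable for \<open>outer_field\<close>, while
    \<open>- B\<close> stays with \<open>g\<close>, and likewise with \<open>f\<close>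
    below.\<close>
  have ao_g: "?a \<omega> * ?o \<omega> = ?h \<omega> * g \<omega>" for \<omega>
    unfolding g_def hits_def by (auto simp: indicator_def)
  have uT_f: "u \<omega> * indicator T \<omega> = ?h \<omega> * f \<omega>" for \<omega>
    unfolding T_def f_def using J by (auto simp: indicator_def hits_def split: if_splits)
  have iao: "integrable M (\<lambda>\<omega>. ?a \<omega> * ?o \<omega>)"
    using integrable_mult_unit_interval[OF iw(3) hM(2)] by (simp add: mult.commute indicator_def)
  have iaov: "integrable M (\<lambda>\<omega>. ?a \<omega> * ?o \<omega> * v \<omega>)"
    using integrable_mult_unit_interval[OF iao vM] v(2) by (simp add: mult.commute)
  have aoH: "(\<lambda>\<omega>. ?a \<omega> * ?o \<omega>) \<in> borel_measurable ?H"
    by (intro borel_measurable_times a_H hm)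
  have hcH: "(\<lambda>\<omega>. ?h \<omega> * c \<omega>) \<in> borel_measurable ?H" by (intro borel_measurable_times cm hm)
  have ihc: "integrable M (\<lambda>\<omega>. ?h \<omega> * c \<omega>)"
    by (rule integrable_mult_unit_interval[OF ci hM(1)]) (simp add: indicator_def)
  have f01: "AE \<omega> in M. f \<omega> \<in> {0..1}"
    by (rule AE_I2) (use fg(4) in \<open>simp add: f_def\<close>)
  have ihcf: "integrable M (\<lambda>\<omega>. ?h \<omega> * c \<omega> * f \<omega>)"
    using integrable_mult_unit_interval[OF ihc borel_measurable_integrable[OF fg(2)] f01] by (simp add: mult.commute)
  have iaoc: "integrable M (\<lambda>\<omega>. ?a \<omega> * ?o \<omega> * c \<omega>)"
    unfolding c_def using iaov vM by (intro H.real_cond_exp_intg(1) aoH)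
  have ihcg: "integrable M (\<lambda>\<omega>. ?h \<omega> * c \<omega> * g \<omega>)"
    using iaoc by (simp add: ao_g mult_ac)
  have "(\<integral>\<omega>. u \<omega> * indicator T \<omega> * v \<omega> \<partial>M) = (\<integral>\<omega>. u \<omega> * v \<omega> * indicator T \<omega> \<partial>M)"
    by (simp add: mult_ac)
  also have "\<dots> = (\<integral>\<omega>. ?a \<omega> * v \<omega> * ?o \<omega> \<partial>M)"
    unfolding T_def by (rule sample_split_integral[OF B A J u v])
  also have "\<dots> = (\<integral>\<omega>. ?a \<omega> * ?o \<omega> * v \<omega> \<partial>M)" by (simp add: mult_ac)
  also have "\<dots> = (\<integral>\<omega>. ?a \<omega> * ?o \<omega> * c \<omega> \<partial>M)"
    unfolding c_def by (rule H.real_cond_exp_intg(2)[OF iaov aoH vM, symmetric])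
  also have "\<dots> = (\<integral>\<omega>. ?h \<omega> * c \<omega> * g \<omega> \<partial>M)" by (simp add: ao_g mult_ac)
  also have "\<dots> = (\<integral>\<omega>. ?h \<omega> * c \<omega> * real_cond_exp M ?H g \<omega> \<partial>M)"
    by (rule H.real_cond_exp_intg(2)[OF ihcg hcH borel_measurable_integrable[OF fg(3)], symmetric])
  also have "\<dots> = (\<integral>\<omega>. ?h \<omega> * c \<omega> * real_cond_exp M ?H f \<omega> \<partial>M)"
    using fg(1) measurable_from_subalg[OF of(4) hcH] by (intro integral_cong_AE) auto
  also have "\<dots> = (\<integral>\<omega>. ?h \<omega> * c \<omega> * f \<omega> \<partial>M)"
    by (rule H.real_cond_exp_intg(2)[OF ihcf hcH borel_measurable_integrable[OF fg(2)]])
  also have "\<dots> = (\<integral>\<omega>. u \<omega> * indicator T \<omega> * c \<omega> \<partial>M)" unfolding uT_f by (simp add: mult_ac)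
  finally show ?thesis unfolding c_def .
qed

definition outside_pattern :: "'x set \<Rightarrow> nat set \<Rightarrow> 'w set" where
  "outside_pattern B J = hits {1..n} (\<lambda>i. if i \<in> J then - B else B)"

text \<open>Each summand is conditioned on \<open>P B\<close> and the observations with index in \<open>J\<close> only; the
  observations inside \<open>B\<close> affect the sum through the pattern alone.\<close>

definition pattern_cond_exp :: "'x set \<Rightarrow> ('w \<Rightarrow> real) \<Rightarrow> 'w \<Rightarrow> real" where
  "pattern_cond_exp B v \<omega> =
     (\<Sum>J\<in>Pow {1..n}. indicator (outside_pattern B J) \<omega> * real_cond_exp M (outer_field B J) v \<omega>)"

lemma sum_outside_pattern:
  assumes "\<omega> \<in> space M"
  shows "(\<Sum>J\<in>Pow {1..n}. indicat_real (outside_pattern B J) \<omega>) = 1"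
proof -
  let ?J = "{i\<in>{1..n}. X i \<omega> \<notin> B}"
  have "indicat_real (outside_pattern B J) \<omega> = (if J = ?J then 1 else 0)" if "J \<in> Pow {1..n}" for J
    using assms that unfolding outside_pattern_def hits_def by (auto simp: indicator_def split: if_splits)
  then have "(\<Sum>J\<in>Pow {1..n}. indicat_real (outside_pattern B J) \<omega>) = (\<Sum>J\<in>Pow {1..n}. if J = ?J then 1 else 0)"
    by (rule sum.cong[OF refl])
  also have "\<dots> = 1" by (subst sum.delta) auto
  finally show ?thesis .
qed

text \<open>Exactly one pattern occurs, so the event is cut into the pieces \<open>T J\<close> and
  the fixed-pattern identity is summed over \<open>J\<close>.\<close>

lemma pattern_cond_exp_integral:
  assumes B: "B \<in> finite_unions \<A>" and A: "\<And>i. A i \<in> sets borel"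
    and u: "u \<in> borel_measurable (past B)" "\<And>\<omega>. \<omega> \<in> space M \<Longrightarrow> u \<omega> \<in> {0..1}"
    and v: "v \<in> borel_measurable (future B)" "\<And>\<omega>. \<omega> \<in> space M \<Longrightarrow> v \<omega> \<in> {0..1}"
  shows "(\<integral>\<omega>. u \<omega> * indicator (hits {1..n} A) \<omega> * v \<omega> \<partial>M) =
     (\<integral>\<omega>. u \<omega> * indicator (hits {1..n} A) \<omega> * pattern_cond_exp B v \<omega> \<partial>M)"
    and "integrable M (pattern_cond_exp B v)"
proof -
  note Bb = finite_unions_borel[OF B]
  define T where "T J = hits {1..n} (\<lambda>i. if i \<in> J then A i - B else A i \<inter> B)" for J
  let ?g = "\<lambda>J. real_cond_exp M (outer_field B J) v"
  have TM: "T J \<in> sets M" and pM: "outside_pattern B J \<in> sets M" for J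
    unfolding T_def outside_pattern_def using A Bb by (auto intro!: hits_events)
  have eq: "indicat_real (hits {1..n} A) \<omega> * indicat_real (outside_pattern B J) \<omega> = indicat_real (T J) \<omega>" for \<omega> J
    unfolding outside_pattern_def T_def hits_def by (auto simp: indicator_def split: if_splits)
  have uM: "u \<in> borel_measurable M" by (rule measurable_from_subalg[OF subalgebra_past u(1)])
  have vM: "v \<in> borel_measurable M"
    by (rule measurable_from_subalg[OF subalgebra_null_augment[OF subalgebra_generated_field[OF future_generators_borel[OF B]]] v(1)])
  have iv: "integrable M v" by (rule integrable_const_bound[where B = 1]) (use v(2) vM in auto)
  have ig: "integrable M (?g J)" if "J \<in> Pow {1..n}" for J
  proof -
    have "J \<subseteq> {1..n}" using that by simp
    interpret H: sigma_finite_subalgebra M "outer_field B J"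
      by (rule sigma_finite_subalgebraI[OF outer_field(4)[OF B \<open>J \<subseteq> {1..n}\<close>]])
    show ?thesis by (rule H.real_cond_exp_int(1)[OF iv])
  qed
  show "integrable M (pattern_cond_exp B v)" unfolding pattern_cond_exp_def
    by (intro Bochner_Integration.integrable_sum integrable_mult_unit_interval ig) (use pM in \<open>auto simp: indicator_def\<close>)
  have m01: "(\<lambda>\<omega>. u \<omega> * indicat_real (T J) \<omega>) \<in> borel_measurable M" "AE \<omega> in M. u \<omega> * indicat_real (T J) \<omega> \<in> {0..1}" for J
    using uM TM u(2) by (auto simp: indicator_def)
  have "(\<integral>\<omega>. u \<omega> * indicator (hits {1..n} A) \<omega> * v \<omega> \<partial>M) =
      (\<integral>\<omega>. (\<Sum>J\<in>Pow {1..n}. u \<omega> * indicator (T J) \<omega> * v \<omega>) \<partial>M)"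
  proof (rule Bochner_Integration.integral_cong[OF refl])
    fix \<omega> assume "\<omega> \<in> space M"
    then have "u \<omega> * indicator (hits {1..n} A) \<omega> * v \<omega> =
        u \<omega> * indicator (hits {1..n} A) \<omega> * v \<omega> * (\<Sum>J\<in>Pow {1..n}. indicat_real (outside_pattern B J) \<omega>)"
      using sum_outside_pattern by simp
    then show "u \<omega> * indicator (hits {1..n} A) \<omega> * v \<omega> = (\<Sum>J\<in>Pow {1..n}. u \<omega> * indicator (T J) \<omega> * v \<omega>)"
      by (simp add: sum_distrib_left mult_ac flip: eq)
  qed
  also have "\<dots> = (\<Sum>J\<in>Pow {1..n}. \<integral>\<omega>. u \<omega> * indicator (T J) \<omega> * v \<omega> \<partial>M)"
    by (intro Bochner_Integration.integral_sum integrable_mult_unit_interval[OF iv m01])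
  also have "\<dots> = (\<Sum>J\<in>Pow {1..n}. \<integral>\<omega>. u \<omega> * indicator (T J) \<omega> * ?g J \<omega> \<partial>M)"
    unfolding T_def by (intro sum.cong refl sample_pattern_integral[OF B A _ u v]) auto
  also have "\<dots> = (\<integral>\<omega>. (\<Sum>J\<in>Pow {1..n}. u \<omega> * indicator (T J) \<omega> * ?g J \<omega>) \<partial>M)"
    by (intro Bochner_Integration.integral_sum[symmetric] integrable_mult_unit_interval[OF ig m01])
  also have "\<dots> = (\<integral>\<omega>. u \<omega> * indicator (hits {1..n} A) \<omega> * pattern_cond_exp B v \<omega> \<partial>M)"
    unfolding pattern_cond_exp_def sum_distrib_left eq[symmetric] by (simp only: mult_ac)
  finally show "(\<integral>\<omega>. u \<omega> * indicator (hits {1..n} A) \<omega> * v \<omega> \<partial>M) =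
     (\<integral>\<omega>. u \<omega> * indicator (hits {1..n} A) \<omega> * pattern_cond_exp B v \<omega> \<partial>M)" .
qed

section \<open>Fields generated by the sample with the present or the past\<close>

abbreviation sample_pair :: "'x set \<Rightarrow> 'w \<Rightarrow> (nat \<Rightarrow> 'x) \<times> real" where
  "sample_pair B \<omega> \<equiv> (sample_vector n X \<omega>, P B \<omega>)"

abbreviation pair_field :: "'x set \<Rightarrow> 'w measure" where
  "pair_field B \<equiv> vimage_algebra (space M) (sample_pair B) (sample_space n \<Otimes>\<^sub>M unit_borel)"

abbreviation sample_past :: "'x set \<Rightarrow> 'w measure" where
  "sample_past B \<equiv> sample_past_field M \<A> P n X B"

lemma measurable_sample_vector:
  assumes "\<And>i. i \<in> {1..n} \<Longrightarrow> X i \<in> F \<rightarrow>\<^sub>M borel"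
  shows "sample_vector n X \<in> F \<rightarrow>\<^sub>M sample_space n"
  unfolding sample_vector_def by (rule measurable_restrict) (use assms in auto)

lemma measurable_sample_pair:
  assumes "\<And>i. i \<in> {1..n} \<Longrightarrow> X i \<in> F \<rightarrow>\<^sub>M borel" "P B \<in> F \<rightarrow>\<^sub>M unit_borel"
  shows "sample_pair B \<in> F \<rightarrow>\<^sub>M sample_space n \<Otimes>\<^sub>M unit_borel"
  by (rule measurable_Pair[OF measurable_sample_vector[OF assms(1)] assms(2)])

lemma pair_field_least:
  assumes "space F = space M" "\<And>i. i \<in> {1..n} \<Longrightarrow> X i \<in> F \<rightarrow>\<^sub>M borel" "P B \<in> F \<rightarrow>\<^sub>M unit_borel"
  shows "subalgebra F (pair_field B)"
  using sets_vimage_algebra_subset[OF measurable_sample_pair[OF assms(2,3)]] assms(1)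
  by (simp add: subalgebra_def)

lemma measurable_pair_field:
  assumes B: "B \<in> sets borel"
  shows "sample_pair B \<in> pair_field B \<rightarrow>\<^sub>M sample_space n \<Otimes>\<^sub>M unit_borel"
    and "i \<in> {1..n} \<Longrightarrow> X i \<in> pair_field B \<rightarrow>\<^sub>M borel" and "P B \<in> pair_field B \<rightarrow>\<^sub>M unit_borel"
proof -
  show m: "sample_pair B \<in> pair_field B \<rightarrow>\<^sub>M sample_space n \<Otimes>\<^sub>M unit_borel"
    using measurable_space[OF measurable_sample_pair[OF measurable_X measurable_P[OF B]]]
    by (intro measurable_vimage_algebra1) blast
  show "P B \<in> pair_field B \<rightarrow>\<^sub>M unit_borel"
    using measurable_compose[OF m measurable_snd] by simp
  show "X i \<in> pair_field B \<rightarrow>\<^sub>M borel" if i: "i \<in> {1..n}"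
    using measurable_compose[OF measurable_compose[OF m measurable_fst] measurable_component_singleton[OF i]] i
    by (simp add: sample_vector_def)
qed

text \<open>Rectangles of a past event and an observation event generate the field of past and
  sample; on them the pattern identity can be tested.\<close>

lemma sample_past:
  fixes B :: "'x set" and i :: nat
  defines "N \<equiv> {F \<inter> hits {1..n} A | F A. F \<in> sets (past_field M \<A> P B) \<and> (\<forall>i. A i \<in> sets borel)}"
  shows "subalgebra M (sample_past B)" "sets (sample_past B) = sigma_sets (space M) N"
    "Int_stable N" "space M \<in> N" "subalgebra (sample_past B) (past_field M \<A> P B)"
    "i \<in> {1..n} \<Longrightarrow> X i \<in> sample_past B \<rightarrow>\<^sub>M borel"
proof -
  let ?F = "past_field M \<A> P B" and ?V = "vimage_algebra (space M) (sample_vector n X) (sample_space n)"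
  have sv: "sample_vector n X \<in> M \<rightarrow>\<^sub>M sample_space n" by (rule measurable_sample_vector[OF measurable_X])
  have F: "sets ?F \<subseteq> sets M" "space ?F = space M" using subalgebra_past_field[of B] by (auto simp: subalgebra_def)
  have V: "sets ?V \<subseteq> sets M" by (rule sets_vimage_algebra_subset[OF sv])
  have FV: "sets ?F \<union> sets ?V \<subseteq> Pow (space M)" using F V sets.space_closed by blast
  have S: "sets (sample_past B) = sigma_sets (space M) (sets ?F \<union> sets ?V)"
    unfolding sample_past_field_def by (rule sets_measure_of[OF FV])
  have sp: "space (sample_past B) = space M"
    unfolding sample_past_field_def by (rule space_measure_of[OF FV])
  have "sets ?F \<union> sets ?V \<subseteq> sets M" using F V by blast
  from sets.sigma_sets_subset[OF this] show "subalgebra M (sample_past B)" unfolding subalgebra_def S sp by simp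
  have FS: "sets ?F \<subseteq> sets (sample_past B)" and VS: "sets ?V \<subseteq> sets (sample_past B)" unfolding S by auto
  show "subalgebra (sample_past B) ?F" using FS F(2) sp by (simp add: subalgebra_def)
  show Xi: "X i \<in> sample_past B \<rightarrow>\<^sub>M borel" if i: "i \<in> {1..n}" for i
  proof -
    have "sample_vector n X \<in> ?V \<rightarrow>\<^sub>M sample_space n"
      by (rule measurable_vimage_algebra1) (use measurable_space[OF sv] in blast)
    moreover have "subalgebra (sample_past B) ?V" using VS sp by (simp add: subalgebra_def)
    ultimately have "sample_vector n X \<in> sample_past B \<rightarrow>\<^sub>M sample_space n" by (rule measurable_from_subalg[rotated])
    from measurable_compose[OF this measurable_component_singleton[OF i]] i show ?thesis
      by (simp add: sample_vector_def)
  qed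
  show "Int_stable N"
  proof (rule Int_stableI)
    fix a b assume "a \<in> N" "b \<in> N"
    then obtain k A l A' where a: "a = k \<inter> hits {1..n} A" "k \<in> sets ?F" "\<And>i. A i \<in> sets borel"
      and b: "b = l \<inter> hits {1..n} A'" "l \<in> sets ?F" "\<And>i. A' i \<in> sets borel"
      unfolding N_def by blast
    have "a \<inter> b = (k \<inter> l) \<inter> hits {1..n} (\<lambda>i. A i \<inter> A' i)" unfolding a(1) b(1) hits_def by blast
    moreover have "k \<inter> l \<in> sets ?F" using a(2) b(2) by (rule sets.Int)
    moreover have "\<forall>i. A i \<inter> A' i \<in> sets borel" using a(3) b(3) by (auto intro: sets.Int)
    ultimately show "a \<inter> b \<in> N" unfolding N_def by blast
  qed
  have FN: "F \<in> N" if "F \<in> sets ?F" for F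
  proof -
    have "F = F \<inter> hits {1..n} (\<lambda>_. UNIV)" using sets.sets_into_space[OF that] F(2) by (auto simp: hits_def)
    then show ?thesis unfolding N_def using that by force
  qed
  show "space M \<in> N" by (rule FN) (metis F(2) sets.top)
  have hS: "hits {1..n} A \<in> sets (sample_past B)" if "\<And>i. A i \<in> sets borel" for A
    by (rule hits_sets[OF sp Xi]) (use that in auto)
  have NS: "N \<subseteq> sets (sample_past B)" unfolding N_def using hS FS by auto
  have Np: "N \<subseteq> Pow (space M)" using NS sets.space_closed[of "sample_past B"] sp by auto
  show "sets (sample_past B) = sigma_sets (space M) N"
  proof
    show "sigma_sets (space M) N \<subseteq> sets (sample_past B)" using sets.sigma_sets_subset[OF NS] sp by simp
    let ?N = "sigma (space M) N"
    have setN: "sets ?N = sigma_sets (space M) N" and spN: "space ?N = space M"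
      using Np by (auto intro: sets_measure_of space_measure_of)
    have XN: "X i \<in> ?N \<rightarrow>\<^sub>M borel" if i: "i \<in> {1..n}" for i
    proof (rule measurableI)
      fix A assume A: "A \<in> sets (borel :: 'x measure)"
      let ?A = "\<lambda>j. if j = i then A else UNIV"
      have "X i -` A \<inter> space M = space M \<inter> hits {1..n} ?A"
        using i by (auto simp: hits_def)
      moreover have "space M \<in> sets ?F" by (metis F(2) sets.top)
      moreover have "\<forall>j. ?A j \<in> sets borel" using A by simp
      ultimately have "X i -` A \<inter> space M \<in> N" unfolding N_def by blast
      then show "X i -` A \<inter> space ?N \<in> sets ?N" unfolding setN spN by (rule sigma_sets.Basic)
    qed simp
    have "sets ?V \<subseteq> sets ?N"
      using sets_vimage_algebra_subset[OF measurable_sample_vector[OF XN]] spN by simp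
    moreover have "sets ?F \<subseteq> sets ?N" using FN unfolding setN by auto
    ultimately have "sets ?F \<union> sets ?V \<subseteq> sets ?N" by blast
    from sets.sigma_sets_subset[OF this] show "sets (sample_past B) \<subseteq> sigma_sets (space M) N"
      unfolding S spN setN .
  qed
qed

text \<open>\<open>P B\<close> is a function of past masses only up to null sets, hence the enlarged
  field. The larger set \<open>C\<close> is there for the tower property between two stages of the
  past.\<close>

lemma sample_past_pair_field:
  assumes B: "B \<in> finite_unions \<A>" and BC: "B \<subseteq> C"
  shows "subalgebra (null_augment M (sample_past C)) (pair_field B)"
proof (rule pair_field_least)
  have "subalgebra (null_augment M (sample_past C)) (sample_past C)"
    by (rule null_augment_subalgebra[OF sample_past(1)])
  then show "X i \<in> null_augment M (sample_past C) \<rightarrow>\<^sub>M borel" if "i \<in> {1..n}" for i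
    by (rule measurable_from_subalg[OF _ sample_past(6)[OF that]])
  have "subalgebra (null_augment M (sample_past C)) (past C)"
    using null_augment_mono[OF sample_past(1) sample_past(5)] by (simp add: subalgebra_def)
  then have "P B \<in> borel_measurable (null_augment M (sample_past C))"
    by (rule measurable_from_subalg[OF _ P_past_finite_unions[OF B BC]])
  then show "P B \<in> null_augment M (sample_past C) \<rightarrow>\<^sub>M unit_borel"
    by (rule measurable_unit_borelI) (use P_unit_interval[OF finite_unions_borel[OF B]] in simp)
qed simp

text \<open>By the pattern identity on rectangles, \<open>pattern_cond_exp\<close> is a version of
  the conditional expectation given past and sample. Each of its summands is a function of the
  sample and \<open>P B\<close>, so it is also a version given \<open>pair_field\<close>.\<close>

lemma posterior_Markov:
  assumes B: "B \<in> finite_unions \<A>"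
    and v: "v \<in> borel_measurable (future B)" "\<And>\<omega>. \<omega> \<in> space M \<Longrightarrow> v \<omega> \<in> {0..1}"
  shows "AE \<omega> in M. real_cond_exp M (sample_past B) v \<omega> = real_cond_exp M (pair_field B) v \<omega>"
proof -
  note Bb = finite_unions_borel[OF B]
  let ?g = "pattern_cond_exp B v"
  have vM: "v \<in> borel_measurable M"
    by (rule measurable_from_subalg[OF subalgebra_null_augment[OF subalgebra_generated_field[OF future_generators_borel[OF B]]] v(1)])
  have iv: "integrable M v" by (rule integrable_const_bound[where B = 1]) (use v(2) vM in auto)
  have hH: "hits J A \<in> sets (pair_field B)" if "J \<subseteq> {1..n}" "\<And>i. A i \<in> sets borel" for J A
    by (rule hits_sets[OF _ measurable_pair_field(2)[OF Bb]]) (use that in auto)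
  have oH: "subalgebra (pair_field B) (outer_field B J)" if J: "J \<in> Pow {1..n}" for J
  proof -
    have "sets (present B) \<subseteq> sets (pair_field B)"
      by (rule generated_field_least) (use measurable_pair_field(3)[OF Bb] in auto)
    then have "{k \<inter> hits J A | k A. k \<in> sets (present B) \<and> (\<forall>i. A i \<in> sets borel)} \<subseteq> sets (pair_field B)"
      using hH J by auto
    from sets.sigma_sets_subset[OF this] show ?thesis
      using outer_field(1)[OF B] J by (simp add: subalgebra_def)
  qed
  have gH: "?g \<in> borel_measurable (pair_field B)" unfolding pattern_cond_exp_def
  proof (intro borel_measurable_sum borel_measurable_times borel_measurable_indicator)
    fix J assume J: "J \<in> Pow {1..n}"
    show "outside_pattern B J \<in> sets (pair_field B)"
      unfolding outside_pattern_def using Bb by (intro hH) auto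
    show "real_cond_exp M (outer_field B J) v \<in> borel_measurable (pair_field B)"
      by (rule measurable_from_subalg[OF oH[OF J]]) simp
  qed
  have HS: "subalgebra (null_augment M (sample_past B)) (pair_field B)"
    by (rule sample_past_pair_field[OF B order.refl])
  have gi: "integrable M ?g"
    by (rule pattern_cond_exp_integral(2)[OF B _ _ _ v, where A = "\<lambda>_. UNIV" and u = "\<lambda>_. 0"]) auto
  have "AE \<omega> in M. real_cond_exp M (sample_past B) v \<omega> = ?g \<omega>"
  proof (rule real_cond_exp_charact_generator[OF sample_past(1-4) iv gi measurable_from_subalg[OF HS gH]])
    fix E assume "E \<in> {F \<inter> hits {1..n} A | F A. F \<in> sets (past_field M \<A> P B) \<and> (\<forall>i. A i \<in> sets borel)}"
    then obtain F A where E: "E = F \<inter> hits {1..n} A" and F: "F \<in> sets (past_field M \<A> P B)"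
      and A: "\<And>i. A i \<in> sets borel" by blast
    have "F \<in> sets (past B)"
      using F null_augment_subalgebra[OF subalgebra_past_field[of B]] by (auto simp: subalgebra_def)
    then have u: "indicat_real F \<in> borel_measurable (past B)" by simp
    have "indicat_real E \<omega> = indicator F \<omega> * indicator (hits {1..n} A) \<omega>" for \<omega>
      by (simp add: E indicator_def)
    then show "(\<integral>\<omega>\<in>E. v \<omega> \<partial>M) = (\<integral>\<omega>\<in>E. ?g \<omega> \<partial>M)"
      using pattern_cond_exp_integral(1)[OF B A u _ v] by (simp add: set_lebesgue_integral_def indicator_def)
  qed
  with real_cond_exp_null_augment[OF sample_past(1)[of B] iv]
  have *: "AE \<omega> in M. real_cond_exp M (null_augment M (sample_past B)) v \<omega> = ?g \<omega>" by eventually_elim simp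
  have "AE \<omega> in M. real_cond_exp M (null_augment M (sample_past B)) v \<omega> = real_cond_exp M (pair_field B) v \<omega>"
    by (rule real_cond_exp_eq_subalgebra[OF subalgebra_null_augment[OF sample_past(1)] HS iv gH *])
  with real_cond_exp_null_augment[OF sample_past(1)[of B] iv] show ?thesis by eventually_elim simp
qed

end

section \<open>Posterior transition system\<close>

text \<open>The kernel gives conditional probabilities of \<open>Y\<close> set by set, with null
  sets depending on the set. To integrate a function of \<open>Z\<close> and \<open>Y\<close>
  jointly, the joint law is written as the law of \<open>Z\<close> followed by the kernel.\<close>

lemma (in prob_space) real_cond_exp_kernel:
  fixes \<phi> :: "'b \<times> 'c \<Rightarrow> real"
  assumes Z: "Z \<in> M \<rightarrow>\<^sub>M N" and Y: "Y \<in> M \<rightarrow>\<^sub>M L" and K: "K \<in> N \<rightarrow>\<^sub>M prob_algebra L"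
    and kernel: "\<And>\<Gamma>. \<Gamma> \<in> sets L \<Longrightarrow> AE \<omega> in M.
      real_cond_exp M (vimage_algebra (space M) Z N) (indicator {\<omega>\<in>space M. Y \<omega> \<in> \<Gamma>}) \<omega> = measure (K (Z \<omega>)) \<Gamma>"
    and \<phi>: "\<phi> \<in> borel_measurable (N \<Otimes>\<^sub>M L)" "\<And>p. p \<in> space (N \<Otimes>\<^sub>M L) \<Longrightarrow> \<phi> p \<in> {0..1}"
  shows "(\<lambda>z. \<integral>y. \<phi> (z, y) \<partial>K z) \<in> borel_measurable N"
    and "AE \<omega> in M. real_cond_exp M (vimage_algebra (space M) Z N) (\<lambda>\<omega>. \<phi> (Z \<omega>, Y \<omega>)) \<omega> = (\<integral>y. \<phi> (Z \<omega>, y) \<partial>K (Z \<omega>))"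
proof -
  let ?F = "vimage_algebra (space M) Z N" and ?NL = "N \<Otimes>\<^sub>M L"
  let ?L = "\<lambda>z. \<integral>y. \<phi> (z, y) \<partial>K z"
  \<comment> \<open>The law of \<open>(z, Y)\<close> with \<open>Y\<close> drawn from
    \<open>K z\<close>; keeping \<open>z\<close> in the pair makes the joint law a bind.\<close>
  define \<kappa> where "\<kappa> z = distr (K z) ?NL (Pair z)" for z
  have sub: "subalgebra M ?F"
    using sets_vimage_algebra_subset[OF Z] by (simp add: subalgebra_def)
  interpret F: sigma_finite_subalgebra M ?F by (rule sigma_finite_subalgebraI[OF sub])
  have Zsp: "Z \<omega> \<in> space N" if "\<omega> \<in> space M" for \<omega> using measurable_space[OF Z that] .
  have ZF: "Z \<in> ?F \<rightarrow>\<^sub>M N" by (rule measurable_vimage_algebra1) (use Zsp in blast)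
  have Kz: "prob_space (K z)" "sets (K z) = sets L" "space (K z) = space L" if "z \<in> space N" for z
    using measurable_space[OF K that] by (auto simp: space_prob_algebra dest: sets_eq_imp_space_eq)
  have Pair: "Pair z \<in> K z \<rightarrow>\<^sub>M ?NL" if "z \<in> space N" for z
    using measurable_Pair1'[OF that, of L] Kz(2)[OF that] measurable_cong_sets by blast
  have \<kappa>m: "\<kappa> \<in> N \<rightarrow>\<^sub>M subprob_algebra ?NL" unfolding \<kappa>_def
    by (rule measurable_distr2[OF _ measurable_prob_algebraD[OF K]]) simp
  have L\<kappa>: "?L z = (\<integral>p. \<phi> p \<partial>\<kappa> z)" if "z \<in> space N" for z
    unfolding \<kappa>_def by (rule integral_distr[OF Pair[OF that] \<phi>(1), symmetric])
  have "(\<lambda>z. \<integral>p. \<phi> p \<partial>\<kappa> z) \<in> borel_measurable N"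
    by (rule measurable_compose[OF \<kappa>m integral_measurable_subprob_algebra[OF \<phi>(1)]])
  then show Lm: "?L \<in> borel_measurable N" by (rule measurable_cong[THEN iffD2, OF L\<kappa>, rotated])
  have \<phi>sec: "(\<lambda>y. \<phi> (z, y)) \<in> borel_measurable (K z)" if "z \<in> space N" for z
    using measurable_compose[OF Pair[OF that] \<phi>(1)] .
  have \<phi>int: "integrable (K z) (\<lambda>y. \<phi> (z, y))" if "z \<in> space N" for z
  proof -
    interpret Kz: prob_space "K z" by (rule Kz(1)[OF that])
    show ?thesis
      by (rule Kz.integrable_const_bound[where B = 1])
        (use \<phi>(2) \<phi>sec[OF that] that Kz(3)[OF that] in \<open>auto simp: space_pair_measure\<close>)
  qed
  have L0: "0 \<le> ?L z" if "z \<in> space N" for z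
    by (rule integral_nonneg_AE) (use \<phi>(2) that Kz(3)[OF that] in \<open>auto simp: space_pair_measure\<close>)
  have L1: "?L z \<le> 1" if "z \<in> space N" for z
  proof -
    interpret Kz: prob_space "K z" by (rule Kz(1)[OF that])
    have "?L z \<le> (\<integral>y. 1 \<partial>K z)"
      by (rule integral_mono[OF \<phi>int[OF that]]) (use \<phi>(2) that Kz(3)[OF that] in \<open>auto simp: space_pair_measure\<close>)
    then show ?thesis by (simp add: Kz.prob_space)
  qed
  have ZY: "(\<lambda>\<omega>. (Z \<omega>, Y \<omega>)) \<in> M \<rightarrow>\<^sub>M ?NL" by (rule measurable_Pair[OF Z Y])
  have ne: "space (distr M N Z) \<noteq> {}" using Zsp not_empty by auto
  have \<kappa>d: "\<kappa> \<in> distr M N Z \<rightarrow>\<^sub>M subprob_algebra ?NL" using \<kappa>m by simp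
  \<comment> \<open>Finite measures that agree on rectangles are equal, and on
    \<open>W \<times> \<Gamma>\<close> agreement is the kernel property integrated over
    \<open>Z \<in> W\<close>.\<close>
  have joint: "distr M ?NL (\<lambda>\<omega>. (Z \<omega>, Y \<omega>)) = distr M N Z \<bind> \<kappa>"
  proof (rule measure_eqI_generator_eq)
    let ?E = "{a \<times> b | a b. a \<in> sets N \<and> b \<in> sets L}"
    show "Int_stable ?E" by (rule Int_stable_pair_measure_generator)
    show "?E \<subseteq> Pow (space N \<times> space L)" by (rule pair_measure_closed)
    show "sets (distr M ?NL (\<lambda>\<omega>. (Z \<omega>, Y \<omega>))) = sigma_sets (space N \<times> space L) ?E"
      by (simp add: sets_pair_measure)
    show "sets (distr M N Z \<bind> \<kappa>) = sigma_sets (space N \<times> space L) ?E"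
      using sets_bind[OF _ ne, of \<kappa> ?NL] \<kappa>_def by (simp add: sets_pair_measure)
    show "range (\<lambda>_::nat. space N \<times> space L) \<subseteq> ?E" by auto
    show "(\<Union>i::nat. space N \<times> space L) = space N \<times> space L" by auto
    show "emeasure (distr M ?NL (\<lambda>\<omega>. (Z \<omega>, Y \<omega>))) (space N \<times> space L) \<noteq> \<infinity>" for i :: nat
      using prob_space.emeasure_le_1[OF prob_space_distr[OF ZY]] by (metis ennreal_one_less_top infinity_ennreal_def leD)
    fix X assume "X \<in> ?E"
    then obtain W \<Gamma> where X: "X = W \<times> \<Gamma>" and W: "W \<in> sets N" and \<Gamma>: "\<Gamma> \<in> sets L" by blast
    let ?y = "indicat_real {\<omega>\<in>space M. Y \<omega> \<in> \<Gamma>}" and ?q = "\<lambda>\<omega>. measure (K (Z \<omega>)) \<Gamma>"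
    have yM: "{\<omega>\<in>space M. Y \<omega> \<in> \<Gamma>} \<in> sets M"
      using measurable_sets[OF Y \<Gamma>] by (simp add: vimage_def Int_def conj_commute)
    have WF: "(\<lambda>\<omega>. indicat_real W (Z \<omega>)) \<in> borel_measurable ?F"
      by (rule measurable_compose[OF ZF]) (use W in simp)
    have WM: "(\<lambda>\<omega>. indicat_real W (Z \<omega>)) \<in> borel_measurable M" by (rule measurable_from_subalg[OF sub WF])
    have XM: "(\<lambda>\<omega>. (Z \<omega>, Y \<omega>)) -` X \<inter> space M \<in> sets M"
      by (rule measurable_sets[OF ZY]) (use W \<Gamma> X in auto)
    have ind: "indicat_real ((\<lambda>\<omega>. (Z \<omega>, Y \<omega>)) -` X \<inter> space M) \<omega> = indicator W (Z \<omega>) * ?y \<omega>" if "\<omega> \<in> space M" for \<omega>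
      using that by (auto simp: X indicator_def)
    have qm: "?q \<in> borel_measurable M"
      by (rule measurable_compose[OF Z measurable_compose[OF K measurable_measure_prob_algebra[OF \<Gamma>]]])
    have q01: "?q \<omega> \<in> {0..1}" if "\<omega> \<in> space M" for \<omega>
      using prob_space.prob_le_1[OF Kz(1)[OF Zsp[OF that]]] by simp
    have iWy: "integrable M (\<lambda>\<omega>. indicat_real W (Z \<omega>) * ?y \<omega>)"
      by (rule integrable_const_bound[where B = 1]) (use WM yM in \<open>auto simp: indicator_def\<close>)
    have "emeasure (distr M ?NL (\<lambda>\<omega>. (Z \<omega>, Y \<omega>))) X = emeasure M ((\<lambda>\<omega>. (Z \<omega>, Y \<omega>)) -` X \<inter> space M)"
      by (rule emeasure_distr[OF ZY]) (use W \<Gamma> X in auto)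
    also have "\<dots> = ennreal (\<integral>\<omega>. indicat_real ((\<lambda>\<omega>. (Z \<omega>, Y \<omega>)) -` X \<inter> space M) \<omega> \<partial>M)"
      using XM by (simp add: emeasure_eq_measure)
    also have "(\<integral>\<omega>. indicat_real ((\<lambda>\<omega>. (Z \<omega>, Y \<omega>)) -` X \<inter> space M) \<omega> \<partial>M) = (\<integral>\<omega>. indicator W (Z \<omega>) * ?y \<omega> \<partial>M)"
      by (rule Bochner_Integration.integral_cong[OF refl ind])
    also have "\<dots> = (\<integral>\<omega>. indicator W (Z \<omega>) * real_cond_exp M ?F ?y \<omega> \<partial>M)"
      using yM by (intro F.real_cond_exp_intg(2)[symmetric] iWy WF) simp
    also have "\<dots> = (\<integral>\<omega>. indicator W (Z \<omega>) * ?q \<omega> \<partial>M)"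
      using kernel[OF \<Gamma>] WM qm by (intro integral_cong_AE) auto
    also have "ennreal \<dots> = (\<integral>\<^sup>+\<omega>. ennreal (indicator W (Z \<omega>) * ?q \<omega>) \<partial>M)"
    proof (rule nn_integral_eq_integral[symmetric])
      show "integrable M (\<lambda>\<omega>. indicator W (Z \<omega>) * ?q \<omega>)"
        by (rule integrable_const_bound[where B = 1]) (use WM qm q01 in \<open>auto simp: indicator_def\<close>)
    qed (auto simp: indicator_def)
    also have "\<dots> = (\<integral>\<^sup>+\<omega>. emeasure (\<kappa> (Z \<omega>)) X \<partial>M)"
    proof (rule nn_integral_cong)
      fix \<omega> assume "\<omega> \<in> space M"
      then have z: "Z \<omega> \<in> space N" by (rule Zsp)
      interpret Kz: prob_space "K (Z \<omega>)" by (rule Kz(1)[OF z])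
      have "emeasure (\<kappa> (Z \<omega>)) X = emeasure (K (Z \<omega>)) (Pair (Z \<omega>) -` X \<inter> space (K (Z \<omega>)))"
        unfolding \<kappa>_def by (rule emeasure_distr[OF Pair[OF z]]) (use W \<Gamma> X in auto)
      also have "Pair (Z \<omega>) -` X \<inter> space (K (Z \<omega>)) = (if Z \<omega> \<in> W then \<Gamma> else {})"
        using sets.sets_into_space[OF \<Gamma>] Kz(3)[OF z] by (auto simp: X)
      finally show "ennreal (indicator W (Z \<omega>) * ?q \<omega>) = emeasure (\<kappa> (Z \<omega>)) X"
        by (simp add: indicator_def Kz.emeasure_eq_measure)
    qed
    also have "\<dots> = (\<integral>\<^sup>+z. emeasure (\<kappa> z) X \<partial>distr M N Z)"
    proof (rule nn_integral_distr[symmetric, OF Z])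
      have "X \<in> sets ?NL" using W \<Gamma> X by auto
      from measurable_compose[OF \<kappa>m measurable_emeasure_subprob_algebra[OF this]]
      show "(\<lambda>z. emeasure (\<kappa> z) X) \<in> borel_measurable (distr M N Z)" by simp
    qed
    also have "\<dots> = emeasure (distr M N Z \<bind> \<kappa>) X"
      by (rule emeasure_bind[symmetric, OF ne \<kappa>d]) (use W \<Gamma> X in auto)
    finally show "emeasure (distr M ?NL (\<lambda>\<omega>. (Z \<omega>, Y \<omega>))) X = emeasure (distr M N Z \<bind> \<kappa>) X" .
  qed
  have \<phi>M: "(\<lambda>\<omega>. \<phi> (Z \<omega>, Y \<omega>)) \<in> borel_measurable M" by (rule measurable_compose[OF ZY \<phi>(1)])
  have \<phi>01: "\<phi> (Z \<omega>, Y \<omega>) \<in> {0..1}" if "\<omega> \<in> space M" for \<omega>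
    using measurable_space[OF ZY that] by (rule \<phi>(2))
  have LZF: "(\<lambda>\<omega>. ?L (Z \<omega>)) \<in> borel_measurable ?F" by (rule measurable_compose[OF ZF Lm])
  have LZM: "(\<lambda>\<omega>. ?L (Z \<omega>)) \<in> borel_measurable M" by (rule measurable_from_subalg[OF sub LZF])
  have LZ01: "?L (Z \<omega>) \<in> {0..1}" if "\<omega> \<in> space M" for \<omega> using L0 L1 Zsp[OF that] by simp
  show "AE \<omega> in M. real_cond_exp M ?F (\<lambda>\<omega>. \<phi> (Z \<omega>, Y \<omega>)) \<omega> = ?L (Z \<omega>)"
  proof (rule F.real_cond_exp_charact[OF _ _ _ LZF])
    show "integrable M (\<lambda>\<omega>. \<phi> (Z \<omega>, Y \<omega>))"
      by (rule integrable_const_bound[where B = 1]) (use \<phi>M \<phi>01 in auto)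
    show "integrable M (\<lambda>\<omega>. ?L (Z \<omega>))"
      by (rule integrable_const_bound[where B = 1]) (use LZM LZ01 in auto)
    fix D assume "D \<in> sets ?F"
    then obtain W where W: "W \<in> sets N" and D: "D = Z -` W \<inter> space M"
      using sets_vimage_algebra2[of Z "space M" N] Zsp by auto
    have DM: "D \<in> sets M" unfolding D by (rule measurable_sets[OF Z W])
    \<comment> \<open>Events of the field of \<open>Z\<close> are preimages, so the test set becomes
      a factor \<open>indicator W\<close> under the joint law. Nonnegative integrals are used
      because they pass through the bind.\<close>
    let ?\<psi> = "\<lambda>p. ennreal (indicator W (fst p) * \<phi> p)"
    have \<psi>m: "?\<psi> \<in> borel_measurable ?NL"
    proof -
      have "(\<lambda>p. indicat_real W (fst p)) \<in> borel_measurable ?NL"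
        by (rule measurable_compose[OF measurable_fst]) (use W in simp)
      then show ?thesis using \<phi>(1) by (intro measurable_compose[OF _ measurable_ennreal] borel_measurable_times)
    qed
    have ennD: "ennreal (\<integral>\<omega>\<in>D. f \<omega> \<partial>M) = (\<integral>\<^sup>+\<omega>. ennreal (indicator W (Z \<omega>) * f \<omega>) \<partial>M)"
      if f: "f \<in> borel_measurable M" "\<And>\<omega>. \<omega> \<in> space M \<Longrightarrow> f \<omega> \<in> {0..1}" for f :: "'a \<Rightarrow> real"
    proof -
      have "integrable M (\<lambda>\<omega>. indicator D \<omega> * f \<omega>)"
        by (rule integrable_const_bound[where B = 1]) (use f DM in \<open>auto simp: indicator_def\<close>)
      then have "ennreal (\<integral>\<omega>\<in>D. f \<omega> \<partial>M) = (\<integral>\<^sup>+\<omega>. ennreal (indicator D \<omega> * f \<omega>) \<partial>M)"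
        unfolding set_lebesgue_integral_def real_scaleR_def
        by (intro nn_integral_eq_integral[symmetric]) (use f(2) in \<open>auto simp: indicator_def\<close>)
      also have "\<dots> = (\<integral>\<^sup>+\<omega>. ennreal (indicator W (Z \<omega>) * f \<omega>) \<partial>M)"
        by (rule nn_integral_cong) (auto simp: D indicator_def)
      finally show ?thesis .
    qed
    have "ennreal (\<integral>\<omega>\<in>D. \<phi> (Z \<omega>, Y \<omega>) \<partial>M) = (\<integral>\<^sup>+\<omega>. ?\<psi> (Z \<omega>, Y \<omega>) \<partial>M)"
      using ennD[OF \<phi>M \<phi>01] by simp
    also have "\<dots> = (\<integral>\<^sup>+p. ?\<psi> p \<partial>(distr M N Z \<bind> \<kappa>))"
      unfolding joint[symmetric] using \<psi>m by (intro nn_integral_distr[symmetric] ZY) simp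
    also have "\<dots> = (\<integral>\<^sup>+z. (\<integral>\<^sup>+p. ?\<psi> p \<partial>\<kappa> z) \<partial>distr M N Z)"
      by (rule nn_integral_bind[OF \<psi>m \<kappa>d])
    also have "\<dots> = (\<integral>\<^sup>+\<omega>. (\<integral>\<^sup>+p. ?\<psi> p \<partial>\<kappa> (Z \<omega>)) \<partial>M)"
      using measurable_compose[OF \<kappa>m nn_integral_measurable_subprob_algebra[OF \<psi>m]]
      by (intro nn_integral_distr Z) simp
    also have "\<dots> = (\<integral>\<^sup>+\<omega>. ennreal (indicator W (Z \<omega>) * ?L (Z \<omega>)) \<partial>M)"
    proof (rule nn_integral_cong)
      fix \<omega> assume "\<omega> \<in> space M"
      then have z: "Z \<omega> \<in> space N" by (rule Zsp)
      have "(\<integral>\<^sup>+p. ?\<psi> p \<partial>\<kappa> (Z \<omega>)) = (\<integral>\<^sup>+y. ennreal (indicator W (Z \<omega>) * \<phi> (Z \<omega>, y)) \<partial>K (Z \<omega>))"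
        unfolding \<kappa>_def using \<psi>m by (subst nn_integral_distr[OF Pair[OF z]]) simp_all
      also have "\<dots> = ennreal (\<integral>y. indicator W (Z \<omega>) * \<phi> (Z \<omega>, y) \<partial>K (Z \<omega>))"
        by (rule nn_integral_eq_integral)
          (use \<phi>int[OF z] \<phi>(2) z Kz(3)[OF z] in \<open>auto simp: space_pair_measure indicator_def\<close>)
      finally show "(\<integral>\<^sup>+p. ?\<psi> p \<partial>\<kappa> (Z \<omega>)) = ennreal (indicator W (Z \<omega>) * ?L (Z \<omega>))" by simp
    qed
    also have "\<dots> = ennreal (\<integral>\<omega>\<in>D. ?L (Z \<omega>) \<partial>M)"
      by (rule ennD[OF LZM LZ01, symmetric])
    finally have "ennreal (\<integral>\<omega>\<in>D. \<phi> (Z \<omega>, Y \<omega>) \<partial>M) = ennreal (\<integral>\<omega>\<in>D. ?L (Z \<omega>) \<partial>M)" .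
    moreover have "0 \<le> (\<integral>\<omega>\<in>D. \<phi> (Z \<omega>, Y \<omega>) \<partial>M)" "0 \<le> (\<integral>\<omega>\<in>D. ?L (Z \<omega>) \<partial>M)"
      unfolding set_lebesgue_integral_def using \<phi>01 LZ01
      by (auto intro!: integral_nonneg_AE simp: indicator_def)
    ultimately show "(\<integral>\<omega>\<in>D. \<phi> (Z \<omega>, Y \<omega>) \<partial>M) = (\<integral>\<omega>\<in>D. ?L (Z \<omega>) \<partial>M)" by simp
  qed
qed

section \<open>Markov property and Chapman-Kolmogorov equation of the posterior\<close>

context markov_sample
begin

text \<open>\<open>P C\<close> is a future quantity, so the posterior Markov property leads to
  conditioning on the sample and \<open>P B\<close>, by which the kernel is defined.\<close>

lemma posterior_kernel_Markov:
  assumes B: "B \<in> finite_unions \<A>" and C: "C \<in> finite_unions \<A>" and BC: "B \<subseteq> C"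
    and K: "posterior_transition_kernel M P n X B C K" and \<Gamma>: "\<Gamma> \<in> sets unit_borel"
  shows "AE \<omega> in M. cond_probability M (sample_past B) {\<omega>'\<in>space M. P C \<omega>' \<in> \<Gamma>} \<omega> =
    measure (K (sample_vector n X \<omega>) (P B \<omega>)) \<Gamma>"
proof -
  let ?v = "indicat_real {\<omega>'\<in>space M. P C \<omega>' \<in> \<Gamma>}"
  have "P C \<in> future B \<rightarrow>\<^sub>M unit_borel"
    by (rule measurable_unit_borelI[OF P_future_above[OF B C BC]])
      (use P_unit_interval[OF finite_unions_borel[OF C]] in simp)
  from measurable_sets[OF this \<Gamma>] have "{\<omega>'\<in>space M. P C \<omega>' \<in> \<Gamma>} \<in> sets (future B)"
    by (simp add: vimage_def Int_def conj_commute)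
  then have v: "?v \<in> borel_measurable (future B)" by simp
  have "AE \<omega> in M. real_cond_exp M (sample_past B) ?v \<omega> = real_cond_exp M (pair_field B) ?v \<omega>"
    by (rule posterior_Markov[OF B v]) (auto simp: indicator_def)
  moreover have "AE \<omega> in M. real_cond_exp M (pair_field B) ?v \<omega> = measure (K (sample_vector n X \<omega>) (P B \<omega>)) \<Gamma>"
    using K \<Gamma> unfolding posterior_transition_kernel_def cond_probability_def by blast
  ultimately show ?thesis unfolding cond_probability_def by eventually_elim simp
qed

text \<open>Condition on the sample and the past of \<open>B2\<close> first, then on the sample and
  \<open>P B1\<close>. The inner step gives the kernel from \<open>B2\<close> to \<open>B3\<close>,
  and the outer one integrates it against the kernel from \<open>B1\<close> to
  \<open>B2\<close>.\<close>

lemma posterior_Chapman_Kolmogorov: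
  assumes B: "B1 \<in> finite_unions \<A>" "B2 \<in> finite_unions \<A>" "B3 \<in> finite_unions \<A>" "B1 \<subseteq> B2" "B2 \<subseteq> B3"
    and K12: "posterior_transition_kernel M P n X B1 B2 K12"
    and K23: "posterior_transition_kernel M P n X B2 B3 K23"
    and K13: "posterior_transition_kernel M P n X B1 B3 K13"
    and \<Gamma>: "\<Gamma> \<in> sets unit_borel"
  shows "AE (x, z1) in sample_law M P n X B1. measure (K13 x z1) \<Gamma> = (\<integral>z2. measure (K23 x z2) \<Gamma> \<partial>K12 x z1)"
proof -
  let ?N = "sample_space n \<Otimes>\<^sub>M unit_borel :: ((nat \<Rightarrow> 'x) \<times> real) measure"
  let ?v = "indicat_real {\<omega>\<in>space M. P B3 \<omega> \<in> \<Gamma>}"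
  \<comment> \<open>\<open>z1\<close> is a dummy argument: it lets \<phi> act on
    \<open>(Z, Y)\<close> with \<open>Z\<close> the sample and \<open>P B1\<close>, and
    \<open>Y = P B2\<close>, as the kernel lemma expects.\<close>
  define \<phi> where "\<phi> = (\<lambda>((x, z1 :: real), z2). measure (K23 x z2) \<Gamma>)"
  have Km: "(\<lambda>(x, z). K12 x z) \<in> ?N \<rightarrow>\<^sub>M prob_algebra unit_borel"
    "(\<lambda>(x, z). K23 x z) \<in> ?N \<rightarrow>\<^sub>M prob_algebra unit_borel"
    "(\<lambda>(x, z). K13 x z) \<in> ?N \<rightarrow>\<^sub>M prob_algebra unit_borel"
    using K12 K23 K13 unfolding posterior_transition_kernel_def by blast+
  note Bb = B(1-3)[THEN finite_unions_borel]
  have pair: "sample_pair B1 \<in> M \<rightarrow>\<^sub>M ?N" by (rule measurable_sample_pair[OF measurable_X measurable_P[OF Bb(1)]])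
  have "(\<lambda>p. (fst (fst p), snd p)) \<in> ?N \<Otimes>\<^sub>M unit_borel \<rightarrow>\<^sub>M ?N"
    by (intro measurable_Pair measurable_compose[OF measurable_fst measurable_fst] measurable_snd)
  from measurable_compose[OF this measurable_compose[OF Km(2) measurable_measure_prob_algebra[OF \<Gamma>]]]
  have \<phi>m: "\<phi> \<in> borel_measurable (?N \<Otimes>\<^sub>M unit_borel)" by (simp add: \<phi>_def case_prod_beta')
  have \<phi>01: "\<phi> p \<in> {0..1}" if "p \<in> space (?N \<Otimes>\<^sub>M unit_borel)" for p
  proof -
    have "(fst (fst p), snd p) \<in> space ?N" using that by (auto simp: space_pair_measure)
    from measurable_space[OF Km(2) this] have "prob_space (K23 (fst (fst p)) (snd p))"
      by (simp add: space_prob_algebra)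
    from prob_space.prob_le_1[OF this] show ?thesis by (simp add: \<phi>_def case_prod_beta')
  qed
  have vM: "{\<omega>\<in>space M. P B3 \<omega> \<in> \<Gamma>} \<in> sets M"
    using measurable_sets[OF measurable_P[OF Bb(3)] \<Gamma>] by (simp add: vimage_def Int_def conj_commute)
  then have iv: "integrable M ?v" by (simp add: less_top[symmetric])
  have kernel: "AE \<omega> in M. real_cond_exp M (pair_field B1) (indicator {\<omega>\<in>space M. P B2 \<omega> \<in> \<Delta>}) \<omega> =
      measure ((\<lambda>(x, z). K12 x z) (sample_pair B1 \<omega>)) \<Delta>" if "\<Delta> \<in> sets unit_borel" for \<Delta>
    using K12 that unfolding posterior_transition_kernel_def cond_probability_def by simp
  let ?L = "\<lambda>w. \<integral>z2. \<phi> (w, z2) \<partial>(\<lambda>(x, z). K12 x z) w"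
  have ker: "?L \<in> borel_measurable ?N"
    "AE \<omega> in M. real_cond_exp M (pair_field B1) (\<lambda>\<omega>. \<phi> (sample_pair B1 \<omega>, P B2 \<omega>)) \<omega> = ?L (sample_pair B1 \<omega>)"
    by (rule real_cond_exp_kernel[OF pair measurable_P[OF Bb(2)] Km(1) _ \<phi>m]; fact kernel \<phi>01)+
  \<comment> \<open>The tower property needs \<open>P B1\<close> inside the inner field, which
    inclusion-exclusion yields up to null sets.\<close>
  let ?S = "null_augment M (sample_past B2)"
  have S: "subalgebra M ?S" "subalgebra ?S (pair_field B1)"
    by (rule subalgebra_null_augment[OF sample_past(1)], rule sample_past_pair_field[OF B(1,4)])
  have H: "subalgebra M (pair_field B1)" using S by (auto simp: subalgebra_def)
  interpret H: sigma_finite_subalgebra M "pair_field B1" by (rule sigma_finite_subalgebraI[OF H])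
  have "AE \<omega> in M. real_cond_exp M ?S ?v \<omega> = \<phi> (sample_pair B1 \<omega>, P B2 \<omega>)"
    using real_cond_exp_null_augment[OF sample_past(1)[of B2] iv]
      posterior_kernel_Markov[OF B(2,3,5) K23 \<Gamma>, unfolded cond_probability_def]
    by eventually_elim (simp add: \<phi>_def)
  then have "AE \<omega> in M. real_cond_exp M (pair_field B1) (real_cond_exp M ?S ?v) \<omega> =
      real_cond_exp M (pair_field B1) (\<lambda>\<omega>. \<phi> (sample_pair B1 \<omega>, P B2 \<omega>)) \<omega>"
    by (rule H.real_cond_exp_cong)
      (use measurable_compose[OF measurable_Pair[OF pair measurable_P[OF Bb(2)]] \<phi>m] in simp_all)
  moreover have "AE \<omega> in M. real_cond_exp M (pair_field B1) (real_cond_exp M ?S ?v) \<omega> = real_cond_exp M (pair_field B1) ?v \<omega>"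
    by (rule H.real_cond_exp_nested_subalg[OF S iv])
  moreover have "AE \<omega> in M. real_cond_exp M (pair_field B1) ?v \<omega> = measure (K13 (sample_vector n X \<omega>) (P B1 \<omega>)) \<Gamma>"
    using K13 \<Gamma> unfolding posterior_transition_kernel_def cond_probability_def by blast
  ultimately have ae: "AE \<omega> in M. measure ((\<lambda>(x, z). K13 x z) (sample_pair B1 \<omega>)) \<Gamma> = ?L (sample_pair B1 \<omega>)"
    using ker(2) by eventually_elim simp
  have m13: "(\<lambda>w. measure ((\<lambda>(x, z). K13 x z) w) \<Gamma>) \<in> borel_measurable ?N"
    by (rule measurable_compose[OF Km(3) measurable_measure_prob_algebra[OF \<Gamma>]])
  \<comment> \<open>Passing from almost every \<omega> to almost every point of the law requires the
    set of equality to be measurable; \<open>ker(1)\<close> covers the integral.\<close>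
  have "{w \<in> space ?N. measure ((\<lambda>(x, z). K13 x z) w) \<Gamma> = ?L w} \<in> sets ?N"
    by (rule borel_measurable_eq[OF m13 ker(1)])
  from AE_distr_iff[OF pair this] ae
  have "AE w in sample_law M P n X B1. measure ((\<lambda>(x, z). K13 x z) w) \<Gamma> = ?L w"
    unfolding sample_law_def by blast
  then show ?thesis by eventually_elim (simp add: \<phi>_def case_prod_beta')
qed

end

theorem theorem3p4:
  fixes M :: "'w measure"
    and \<A> :: "'x::t2_space set set"
    and Q :: "'x set \<Rightarrow> 'x set \<Rightarrow> real \<Rightarrow> real measure"
    and P :: "'x set \<Rightarrow> 'w \<Rightarrow> real"
    and n :: nat
    and X :: "nat \<Rightarrow> 'w \<Rightarrow> 'x"
    and QX :: "'x set \<Rightarrow> 'x set \<Rightarrow> (nat \<Rightarrow> 'x) \<Rightarrow> real \<Rightarrow> real measure"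
  assumes "prob_space M"
    and "indexing_collection \<A>"
    and "transition_system \<A> Q"
    and "random_probability_measure M P"
    and "Q_Markov M \<A> Q P"
    and "1 \<le> n"
    and "sample_from M P n X"
    and "\<And>B1 B2. B1 \<in> finite_unions \<A> \<Longrightarrow> B2 \<in> finite_unions \<A> \<Longrightarrow> B1 \<subseteq> B2 \<Longrightarrow>
           posterior_transition_kernel M P n X B1 B2 (QX B1 B2)"
  shows "(\<forall>B1\<in>finite_unions \<A>. \<forall>B2\<in>finite_unions \<A>. \<forall>B3\<in>finite_unions \<A>.
            B1 \<subseteq> B2 \<and> B2 \<subseteq> B3 \<longrightarrow>
            (\<forall>\<Gamma>3\<in>sets unit_borel. AE (x, z1) in sample_law M P n X B1.
               measure (QX B1 B3 x z1) \<Gamma>3 =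
               (\<integral>z2. measure (QX B2 B3 x z2) \<Gamma>3 \<partial>QX B1 B2 x z1))) \<and>
         (\<forall>B1\<in>finite_unions \<A>. \<forall>B2\<in>finite_unions \<A>. B1 \<subseteq> B2 \<longrightarrow>
            (\<forall>\<Gamma>2\<in>sets unit_borel. AE \<omega> in M.
               cond_probability M (sample_past_field M \<A> P n X B1)
                 {\<omega>'\<in>space M. P B2 \<omega>' \<in> \<Gamma>2} \<omega> =
               measure (QX B1 B2 (sample_vector n X \<omega>) (P B1 \<omega>)) \<Gamma>2))"
proof -
  note K = assms(8)
  have "random_probability M P" using assms(1,4)
    by (simp add: random_probability_def random_probability_axioms_def)
  then interpret markov_sample M P \<A> Q n X
    using assms(2,3,5,7)
    by (simp add: markov_sample_def markov_sample_axioms_def markov_random_probability_def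
        markov_random_probability_axioms_def indexed_random_probability_def indexed_random_probability_axioms_def)
  show ?thesis
  proof (intro conjI ballI impI)
    fix B1 B2 B3 \<Gamma>
    assume "B1 \<in> finite_unions \<A>" "B2 \<in> finite_unions \<A>" "B3 \<in> finite_unions \<A>"
      "B1 \<subseteq> B2 \<and> B2 \<subseteq> B3" "\<Gamma> \<in> sets unit_borel"
    then show "AE (x, z1) in sample_law M P n X B1. measure (QX B1 B3 x z1) \<Gamma> =
        (\<integral>z2. measure (QX B2 B3 x z2) \<Gamma> \<partial>QX B1 B2 x z1)"
      by (intro posterior_Chapman_Kolmogorov[where ?B2.0 = B2 and ?B3.0 = B3] K) auto
  next
    fix B1 B2 \<Gamma>
    assume "B1 \<in> finite_unions \<A>" "B2 \<in> finite_unions \<A>" "B1 \<subseteq> B2" "\<Gamma> \<in> sets unit_borel"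
    then show "AE \<omega> in M. cond_probability M (sample_past_field M \<A> P n X B1) {\<omega>'\<in>space M. P B2 \<omega>' \<in> \<Gamma>} \<omega> =
        measure (QX B1 B2 (sample_vector n X \<omega>) (P B1 \<omega>)) \<Gamma>"
      by (intro posterior_kernel_Markov K)
  qed
qed

end
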